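(* Let $q\ge 3$ be a prime power and let $m$ be a positive integer. Then $$e_{m+1}(q,m)=(q-1)q^{m-1}+p_{m-2}.$$
   Context: $\mathbb{F}_q$ is the finite field with $q$ elements. $S=\mathbb{F}_q[X_0,X_1,\dots,X_m]$ and $S_d$ is the $\mathbb{F}_q$-vector space of homogeneous polynomials in $S$ of degree $d$, together with $0$. For homogeneous $F_1,\dots,F_r\in S$, $\mathsf{V}(F_1,\dots,F_r)$ denotes the set of their common zeros in $\mathbb{P}^m(\mathbb{F}_q)$ (only $\mathbb{F}_q$-rational points). For $1\le r\le\binom{m+d}{d}$, $$e_r(d,m):=\max\{|\mathsf{V}(F_1,\dots,F_r)| : F_1,\dots,F_r\in S_d \text{ linearly independent over } \mathbb{F}_q\};$$ here it is used with $d=q$ and $r=m+1$. For $k\ge 0$, $p_k:=q^k+q^{k-1}+\dots+q+1$, and $p_k:=0$ for $k<0$. *)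

theory Defs
  imports Complex_Main "HOL-Library.Poly_Mapping" "HOL-Library.Cardinality"
begin

text \<open>
  A polynomial in the variables \<open>X\<^sub>0, X\<^sub>1, \<dots>\<close> is a finitely supported map from monomials to
  coefficients, and a monomial is a finitely supported map from variable indices to exponents.
  The restriction to \<open>X\<^sub>0, \<dots>, X\<^sub>m\<close> is made in \<open>forms\<close> below.
\<close>

type_synonym 'a mpoly = "(nat \<Rightarrow>\<^sub>0 nat) \<Rightarrow>\<^sub>0 'a"

definition mon_degree :: "(nat \<Rightarrow>\<^sub>0 nat) \<Rightarrow> nat" where
  "mon_degree u = (\<Sum>i\<in>Poly_Mapping.keys u. Poly_Mapping.lookup u i)"

definition mpoly_eval :: "(nat \<Rightarrow> 'a) \<Rightarrow> 'a::comm_semiring_1 mpoly \<Rightarrow> 'a" where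
  "mpoly_eval x F =
     (\<Sum>u\<in>Poly_Mapping.keys F. Poly_Mapping.lookup F u *
        (\<Prod>i\<in>Poly_Mapping.keys u. x i ^ Poly_Mapping.lookup u i))"

text \<open>The space \<open>S\<^sub>d\<close> of forms of degree \<open>d\<close> in \<open>X\<^sub>0, \<dots>, X\<^sub>m\<close>; it contains \<open>0\<close>, which has no keys.\<close>

definition forms :: "nat \<Rightarrow> nat \<Rightarrow> 'a::zero mpoly set" where
  "forms m d = {F. \<forall>u\<in>Poly_Mapping.keys F. Poly_Mapping.keys u \<subseteq> {..m} \<and> mon_degree u = d}"

definition mpoly_scale :: "'a::field \<Rightarrow> 'a mpoly \<Rightarrow> 'a mpoly" where
  "mpoly_scale c F = Poly_Mapping.map ((*) c) F"

lemma lookup_mpoly_scale: "Poly_Mapping.lookup (mpoly_scale c F) u = c * Poly_Mapping.lookup F u"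
  by (simp add: mpoly_scale_def Poly_Mapping.map.rep_eq when_def)

text \<open>This provides \<open>mpoly.independent\<close>, linear independence of sets of polynomials over \<open>'a\<close>.\<close>

global_interpretation mpoly: vector_space "mpoly_scale :: 'a::field \<Rightarrow> 'a mpoly \<Rightarrow> 'a mpoly"
  by unfold_locales
    (auto intro!: poly_mapping_eqI simp: lookup_mpoly_scale lookup_add algebra_simps)

text \<open>
  A vector of \<open>'a\<^bsup>m+1\<^esup>\<close> is a function on all of \<open>nat\<close> that vanishes beyond index \<open>m\<close>. A point of
  projective space is a class of nonzero vectors modulo nonzero scalars.
\<close>

definition nonzero_vecs :: "nat \<Rightarrow> (nat \<Rightarrow> 'a::zero) set" where
  "nonzero_vecs m = {x. (\<forall>i>m. x i = 0) \<and> (\<exists>i\<le>m. x i \<noteq> 0)}"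

definition proj_rel :: "nat \<Rightarrow> ((nat \<Rightarrow> 'a::field) \<times> (nat \<Rightarrow> 'a)) set" where
  "proj_rel m = {(x, y). x \<in> nonzero_vecs m \<and> y \<in> nonzero_vecs m \<and>
                         (\<exists>c. c \<noteq> 0 \<and> y = (\<lambda>i. c * x i))}"

lemma equiv_proj_rel: "equiv (nonzero_vecs m) (proj_rel m :: ((nat \<Rightarrow> 'a::field) \<times> _) set)"
proof (intro equivI refl_onI symI transI)
  show "proj_rel m \<subseteq> nonzero_vecs m \<times> (nonzero_vecs m :: (nat \<Rightarrow> 'a) set)"
    by (auto simp: proj_rel_def)
next
  fix x :: "nat \<Rightarrow> 'a" assume "x \<in> nonzero_vecs m"
  then show "(x, x) \<in> proj_rel m"
    by (auto simp: proj_rel_def intro!: exI[of _ 1])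
next
  fix x y :: "nat \<Rightarrow> 'a" assume "(x, y) \<in> proj_rel m"
  then obtain c where "x \<in> nonzero_vecs m" "y \<in> nonzero_vecs m" "c \<noteq> 0" "y = (\<lambda>i. c * x i)"
    by (auto simp: proj_rel_def)
  then show "(y, x) \<in> proj_rel m"
    by (auto simp: proj_rel_def intro!: exI[of _ "inverse c"])
next
  fix x y z :: "nat \<Rightarrow> 'a" assume "(x, y) \<in> proj_rel m" "(y, z) \<in> proj_rel m"
  then obtain c d where "x \<in> nonzero_vecs m" "z \<in> nonzero_vecs m" "c \<noteq> 0" "d \<noteq> 0"
      "y = (\<lambda>i. c * x i)" "z = (\<lambda>i. d * y i)"
    by (auto simp: proj_rel_def)
  then show "(x, z) \<in> proj_rel m"
    by (auto simp: proj_rel_def mult.assoc intro!: exI[of _ "d * c"])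
qed

definition proj_space :: "nat \<Rightarrow> (nat \<Rightarrow> 'a::field) set set" where
  "proj_space m = nonzero_vecs m // proj_rel m"

lemma finite_proj_space: "finite (proj_space m :: (nat \<Rightarrow> 'a::{field,finite}) set set)"
proof -
  have "finite {x :: nat \<Rightarrow> 'a. \<forall>i. (i \<in> {..m} \<longrightarrow> x i \<in> UNIV) \<and> (i \<notin> {..m} \<longrightarrow> x i = 0)}"
    by (intro finite_set_of_finite_funs) auto
  then have "finite (nonzero_vecs m :: (nat \<Rightarrow> 'a) set)"
    by (rule rev_finite_subset) (auto simp: nonzero_vecs_def)
  then show ?thesis
    unfolding proj_space_def
    by (rule finite_quotient) (auto simp: proj_rel_def)
qed

definition proj_zeros :: "nat \<Rightarrow> 'a::field mpoly set \<Rightarrow> (nat \<Rightarrow> 'a) set set" where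
  "proj_zeros m \<F> = {P \<in> proj_space m. \<forall>F\<in>\<F>. \<forall>x\<in>P. mpoly_eval x F = 0}"

text \<open>
  A linearly independent family has no repetitions and its zero locus does not depend on the
  order, so \<open>r\<close> linearly independent forms are given as an independent set of \<open>r\<close> forms.
  The field enters only as a type, hence the argument of type \<open>'a itself\<close>.
\<close>

definition max_zeros :: "'a::{field,finite} itself \<Rightarrow> nat \<Rightarrow> nat \<Rightarrow> nat \<Rightarrow> nat" where
  "max_zeros _ r d m =
     Max {card (proj_zeros m \<F>) | \<F> :: 'a mpoly set.
            \<F> \<subseteq> forms m d \<and> finite \<F> \<and> card \<F> = r \<and> mpoly.independent \<F>}"

definition proj_count :: "nat \<Rightarrow> int \<Rightarrow> nat" where
  "proj_count q k = (if k < 0 then 0 else \<Sum>i\<le>nat k. q ^ i)"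

end

theory Submission
  imports Defs "HOL-Library.Function_Algebras" "HOL-Library.FuncSet"
    "HOL-Computational_Algebra.Polynomial"
begin

text \<open>
  Passing to complements, one has to show that a space \<open>W\<close> of forms of degree \<open>q\<close> in \<open>m + 1\<close>
  variables with more than \<open>q\<^sup>m\<close> elements has at least \<open>2 q\<^sup>m\<^sup>-\<^sup>1\<close> points in its support, by induction
  on \<open>m\<close>. If the restriction of \<open>W\<close> to every hyperplane of the shape \<open>X\<^sub>m = b\<^sub>0 X\<^sub>0 + \<dots> + b\<^sub>m\<^sub>-\<^sub>1 X\<^sub>m\<^sub>-\<^sub>1\<close>
  is still large, the bound follows by averaging over these hyperplanes. Otherwise the members of \<open>W\<close>
  vanishing on one of them form a space with more than \<open>q\<close> elements; dividing by the linear form gives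
  polynomials of degree at most \<open>q - 1\<close> on the affine complement, for which the first, second
  and \<open>(m+1)\<close>-st generalized Hamming weights of Reed-Muller codes are needed. These are bounded by
  slicing along the last variable, considering leading coefficients. Equality holds for the forms
  \<open>X\<^sub>i (X\<^sub>0\<^sup>q\<^sup>-\<^sup>1 - X\<^sub>1\<^sup>q\<^sup>-\<^sup>1)\<close>.

  Dimensions are measured by cardinalities: a space of dimension greater than \<open>k\<close> is one with more than
  \<open>q\<^sup>k\<close> elements. Since only these cardinalities matter, additive subgroups suffice.
\<close>

section \<open>Finite additive groups\<close>

definition additive_subgroup :: "'g::ab_group_add set \<Rightarrow> bool" where
  "additive_subgroup U \<longleftrightarrow> 0 \<in> U \<and> (\<forall>f\<in>U. \<forall>g\<in>U. f - g \<in> U)"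

lemma additive_subgroup_add:
  assumes "additive_subgroup U" "f \<in> U" "g \<in> U"
  shows "f + g \<in> U"
proof -
  have "f - (0 - g) \<in> U"
    using assms unfolding additive_subgroup_def by blast
  then show ?thesis by simp
qed

lemma additive_subgroup_image:
  fixes \<phi> :: "'g::ab_group_add \<Rightarrow> 'h::ab_group_add"
  assumes "additive_subgroup U" "\<And>f g. f \<in> U \<Longrightarrow> g \<in> U \<Longrightarrow> \<phi> (f - g) = \<phi> f - \<phi> g"
  shows "additive_subgroup (\<phi> ` U)"
proof -
  have "\<phi> 0 = 0"
    using assms(2)[of 0 0] assms(1) by (simp add: additive_subgroup_def)
  then show ?thesis
    using assms by (force simp: additive_subgroup_def simp flip: assms(2))
qed

lemma additive_subgroup_kernel:
  fixes \<phi> :: "'g::ab_group_add \<Rightarrow> 'h::ab_group_add"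
  assumes "additive_subgroup U" "\<And>f g. f \<in> U \<Longrightarrow> g \<in> U \<Longrightarrow> \<phi> (f - g) = \<phi> f - \<phi> g"
  shows "additive_subgroup {f \<in> U. \<phi> f = 0}"
proof -
  have "\<phi> 0 = 0"
    using assms(2)[of 0 0] assms(1) by (simp add: additive_subgroup_def)
  then show ?thesis
    using assms unfolding additive_subgroup_def by auto
qed

text \<open>The nonempty fibres of \<open>\<phi>\<close> on \<open>U\<close> are translates of the
  kernel. Additivity is asked for on \<open>U\<close> only, since \<open>fibre_coeff\<close> will be
  known to be additive just on functions of bounded degree.\<close>

lemma card_eq_card_image_times_card_kernel:
  fixes \<phi> :: "'g::ab_group_add \<Rightarrow> 'h::ab_group_add"
  assumes U: "additive_subgroup U" "finite U"
    and \<phi>: "\<And>f g. f \<in> U \<Longrightarrow> g \<in> U \<Longrightarrow> \<phi> (f - g) = \<phi> f - \<phi> g"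
  shows "card U = card (\<phi> ` U) * card {f \<in> U. \<phi> f = 0}"
proof -
  have "card {f \<in> U. \<phi> f = y} = card {f \<in> U. \<phi> f = 0}" if "y \<in> \<phi> ` U" for y
  proof -
    obtain g where g: "g \<in> U" "y = \<phi> g" using \<open>y \<in> \<phi> ` U\<close> by auto
    have plus: "\<phi> (f + g) = \<phi> f + \<phi> g" if "f \<in> U" for f
      using \<phi>[OF additive_subgroup_add[OF U(1) that g(1)] g(1)] by simp
    have "bij_betw (\<lambda>f. f - g) {f \<in> U. \<phi> f = y} {f \<in> U. \<phi> f = 0}"
      using U(1) g plus additive_subgroup_add[OF U(1)]
      by (intro bij_betw_byWitness[where f' = "\<lambda>f. f + g"])
        (auto simp: \<phi> additive_subgroup_def)
    then show ?thesis by (rule bij_betw_same_card)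
  qed
  then have "(\<Sum>y\<in>\<phi> ` U. card {f \<in> U. \<phi> f = y}) = card (\<phi> ` U) * card {f \<in> U. \<phi> f = 0}"
    by simp
  moreover have "card U = (\<Sum>y\<in>\<phi> ` U. card {f \<in> U. \<phi> f = y})"
    using sum.image_gen[OF U(2), of "\<lambda>_. 1" \<phi>] by (simp only: card_eq_sum)
  ultimately show ?thesis by simp
qed

section \<open>Polynomial functions\<close>

inductive apoly :: "nat \<Rightarrow> nat \<Rightarrow> ((nat \<Rightarrow> 'a::comm_ring_1) \<Rightarrow> 'a) \<Rightarrow> bool" for n where
  const: "apoly n d (\<lambda>_. c)"
| add: "apoly n d f \<Longrightarrow> apoly n d g \<Longrightarrow> apoly n d (\<lambda>x. f x + g x)"
| var: "i < n \<Longrightarrow> apoly n d f \<Longrightarrow> apoly n (Suc d) (\<lambda>x. x i * f x)"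

inductive hform :: "nat \<Rightarrow> nat \<Rightarrow> ((nat \<Rightarrow> 'a::comm_ring_1) \<Rightarrow> 'a) \<Rightarrow> bool" for n where
  zero: "hform n d (\<lambda>_. 0)"
| const: "hform n 0 (\<lambda>_. c)"
| add: "hform n d f \<Longrightarrow> hform n d g \<Longrightarrow> hform n d (\<lambda>x. f x + g x)"
| var: "i < n \<Longrightarrow> hform n d f \<Longrightarrow> hform n (Suc d) (\<lambda>x. x i * f x)"

lemma apoly_cong:
  assumes "apoly n d f" "\<And>i. i < n \<Longrightarrow> x i = y i"
  shows "f x = f y"
  using assms by (induction rule: apoly.induct) auto

lemma hform_cong:
  assumes "hform n d f" "\<And>i. i < n \<Longrightarrow> x i = y i"
  shows "f x = f y"
  using assms by (induction rule: hform.induct) auto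

lemma apoly_Suc: "apoly n d f \<Longrightarrow> apoly n (Suc d) f"
  by (induction rule: apoly.induct) (auto intro: apoly.intros)

lemma hform_cmul: "hform n d f \<Longrightarrow> hform n d (\<lambda>x. c * f x)"
proof (induction rule: hform.induct)
  case (var i d f)
  then show ?case
    using hform.var[of i n d "\<lambda>x. c * f x"] by (simp add: mult.left_commute)
next
  case (zero d)
  then show ?case by (simp add: hform.zero)
qed (auto simp: distrib_left intro: hform.intros)

lemma hform_sum: "(\<And>i. i \<in> A \<Longrightarrow> hform n d (f i)) \<Longrightarrow> hform n d (\<lambda>x. \<Sum>i\<in>A. f i x)"
  by (induction A rule: infinite_finite_induct) (auto intro: hform.zero hform.add)

lemma hform_scale: "hform n d f \<Longrightarrow> f (\<lambda>i. c * x i) = c ^ d * f x"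
  by (induction rule: hform.induct) (simp_all add: algebra_simps)

lemma hform_0:
  assumes "hform n 0 f"
  shows "f x = f y"
  using assms by (induction "0 :: nat" f rule: hform.induct) auto

lemma hform_dehomogenize: "hform (Suc n) d f \<Longrightarrow> apoly n d (\<lambda>x. f (x(n := 1)))"
proof (induction rule: hform.induct)
  case (var i d f)
  then show ?case
    using apoly.var[of i n d "\<lambda>x. f (x(n := 1))"] apoly_Suc[of n d "\<lambda>x. f (x(n := 1))"]
    by (cases "i = n") (simp_all add: less_Suc_eq fun_upd_other fun_upd_same del: fun_upd_apply)
qed (auto intro: apoly.intros)

text \<open>Subtracting the value at \<open>x n = 0\<close> removes the monomials without the last
  variable; each remaining one loses a factor of degree 1 or more when that variable becomes 1. This
  takes the place of division by the variable.\<close>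

lemma hform_dehomogenize_vanishing:
  assumes "hform (Suc n) (Suc d) f"
  shows "apoly n d (\<lambda>x. f (x(n := 1)) - f (x(n := 0)))"
  using assms
proof (induction "Suc d" f arbitrary: d rule: hform.induct)
  case zero
  then show ?case by (simp add: apoly.const)
next
  case (add f g)
  then show ?case
    using apoly.add[OF add(2) add(4)] by (simp add: algebra_simps)
next
  case (var i d' f)
  show ?case
  proof (cases "i = n")
    case True
    then show ?thesis
      using var hform_dehomogenize[of n d' f] by simp
  next
    case False
    then have i: "i < n" using var by simp
    show ?thesis
    \<comment> \<open>In degree 0 there is no smaller degree for the induction hypothesis, but then
      \<open>f\<close> is constant and the difference is 0.\<close>
    proof (cases d')
      case 0
      then have "f (x(n := 1)) = f (x(n := 0))" for x
        using hform_0 \<open>hform (Suc n) d' f\<close> by blast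
      then show ?thesis
        using False by (simp add: apoly.const)
    next
      case (Suc k)
      then have "apoly n k (\<lambda>x. f (x(n := 1)) - f (x(n := 0)))"
        using var by blast
      from apoly.var[OF i this] show ?thesis
        using False Suc var by (simp add: algebra_simps)
    qed
  qed
qed

lemma hform_lin_mult:
  assumes "k \<le> n" "hform n d f"
  shows "hform n (Suc d) (\<lambda>x. (\<Sum>i<k. b i * x i) * f x)"
proof -
  have "hform n (Suc d) (\<lambda>x. \<Sum>i<k. b i * (x i * f x))"
    using assms by (intro hform_sum hform_cmul hform.var) auto
  then show ?thesis by (simp add: sum_distrib_right mult.assoc)
qed

lemma hform_restrict:
  assumes "hform (Suc n) d f"
  shows "hform n d (\<lambda>x. f (x(n := \<Sum>i<n. b i * x i)))"
  using assms
proof (induction rule: hform.induct)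
  case (var i d f)
  let ?g = "\<lambda>x. f (x(n := \<Sum>i<n. b i * x i))"
  have "hform n (Suc d) (\<lambda>x. (\<Sum>i<n. b i * x i) * ?g x)"
    by (intro hform_lin_mult var.IH order.refl)
  then show ?case
    using var hform.var[of i n d ?g]
    by (cases "i = n") (simp_all add: less_Suc_eq fun_upd_other fun_upd_same del: fun_upd_apply)
qed (auto intro: hform.intros)

text \<open>This change of coordinates turns the hyperplane
  \<open>x n = (\<Sum>i<n. b i * x i)\<close> into \<open>x n = 0\<close>, where
  \<open>hform_dehomogenize_vanishing\<close> applies.\<close>

lemma hform_shear:
  assumes "hform (Suc n) d f"
  shows "hform (Suc n) d (\<lambda>x. f (x(n := x n + (\<Sum>i<n. b i * x i))))"
  using assms
proof (induction rule: hform.induct)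
  case (var i d f)
  let ?g = "\<lambda>x. f (x(n := x n + (\<Sum>i<n. b i * x i)))"
  have "hform (Suc n) (Suc d) (\<lambda>x. x n * ?g x + (\<Sum>i<n. b i * x i) * ?g x)"
    by (intro hform.add hform.var hform_lin_mult var.IH) simp_all
  then show ?case
    using var hform.var[of i "Suc n" d ?g]
    by (cases "i = n")
      (simp_all add: fun_upd_other fun_upd_same distrib_right del: fun_upd_apply)
qed (auto intro: hform.intros)

text \<open>The power \<open>x n ^ t\<close> uses up \<open>t\<close> units of the degree, so its
  coefficient keeps degree at most \<open>d - t\<close>.\<close>

lemma apoly_expand:
  assumes "apoly (Suc n) d f"
  shows "\<exists>c. (\<forall>t\<le>d. apoly n (d - t) (c t)) \<and> (\<forall>x. f x = (\<Sum>t\<le>d. c t x * x n ^ t))"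
  using assms
proof (induction rule: apoly.induct)
  case (const d c)
  have "(\<Sum>t\<le>d. (if t = 0 then c else 0) * x n ^ t) = (\<Sum>t\<le>d. if t = 0 then c else 0)" for x :: "nat \<Rightarrow> 'a"
    by (intro sum.cong) auto
  then have "\<forall>x :: nat \<Rightarrow> 'a. c = (\<Sum>t\<le>d. (if t = 0 then c else 0) * x n ^ t)"
    by simp
  then show ?case
    by (intro exI[of _ "\<lambda>t x. if t = 0 then c else 0"]) (auto intro: apoly.const)
next
  case (add d f g)
  then obtain c c' where
    "\<forall>t\<le>d. apoly n (d - t) (c t)" "\<forall>x. f x = (\<Sum>t\<le>d. c t x * x n ^ t)"
    "\<forall>t\<le>d. apoly n (d - t) (c' t)" "\<forall>x. g x = (\<Sum>t\<le>d. c' t x * x n ^ t)"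
    by blast
  then show ?case
    by (intro exI[of _ "\<lambda>t x. c t x + c' t x"])
      (auto intro: apoly.add simp: sum.distrib distrib_right)
next
  case (var i d f)
  then obtain c where c:
    "\<forall>t\<le>d. apoly n (d - t) (c t)" "\<forall>x. f x = (\<Sum>t\<le>d. c t x * x n ^ t)"
    by blast
  show ?case
  proof (cases "i = n")
    case True
    have "x i * f x = (\<Sum>t\<le>Suc d. (if t = 0 then 0 else c (t - 1) x) * x n ^ t)" for x
      unfolding True by (subst sum.atMost_Suc_shift) (simp add: c sum_distrib_left mult_ac)
    moreover have "apoly n (Suc d - t) (\<lambda>x. if t = 0 then 0 else c (t - 1) x)" if "t \<le> Suc d" for t
      using c(1) that by (cases t) (auto intro: apoly.const)
    ultimately show ?thesis
      by (intro exI[of _ "\<lambda>t x. if t = 0 then 0 else c (t - 1) x"]) auto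
  next
    case False
    then have i: "i < n" using var by simp
    have "apoly n (Suc d - t) (\<lambda>x. if t \<le> d then x i * c t x else 0)" for t
      using c(1) i apoly.var[of i n "d - t" "c t"]
      by (cases "t \<le> d") (auto intro: apoly.const simp: Suc_diff_le)
    moreover have "x i * f x = (\<Sum>t\<le>Suc d. (if t \<le> d then x i * c t x else 0) * x n ^ t)" for x
      by (simp add: c(2) sum_distrib_left mult_ac)
    ultimately show ?thesis
      by (intro exI[of _ "\<lambda>t x. if t \<le> d then x i * c t x else 0"]) auto
  qed
qed

section \<open>Coefficients with respect to the last variable\<close>

text \<open>On a line over a field with q elements every function has exactly one interpolating
  polynomial of degree below q. Choosing it makes the coefficients depend on the function
  \<open>f\<close> alone and not on a formal polynomial representing it.\<close>

definition fibre_poly :: "nat \<Rightarrow> ((nat \<Rightarrow> 'a::{field,finite}) \<Rightarrow> 'a) \<Rightarrow> (nat \<Rightarrow> 'a) \<Rightarrow> 'a poly" where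
  "fibre_poly n f x = (THE p. degree p < CARD('a) \<and> (\<forall>s. poly p s = f (x(n := s))))"

definition fibre_coeff :: "nat \<Rightarrow> nat \<Rightarrow> ((nat \<Rightarrow> 'a::{field,finite}) \<Rightarrow> 'a) \<Rightarrow> (nat \<Rightarrow> 'a) \<Rightarrow> 'a" where
  "fibre_coeff n t f x = poly.coeff (fibre_poly n f x) t"

lemma fibre_poly_eqI:
  fixes p :: "'a::{field,finite} poly"
  assumes "degree p < CARD('a)" "\<And>s. poly p s = f (x(n := s))"
  shows "fibre_poly n f x = p"
  unfolding fibre_poly_def
proof (rule the_equality)
  fix p' :: "'a poly"
  assume "degree p' < CARD('a) \<and> (\<forall>s. poly p' s = f (x(n := s)))"
  then show "p' = p"
    using assms by (intro poly_eqI_degree[of UNIV]) auto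
qed (use assms in auto)

lemma sum_monom_poly:
  "poly (\<Sum>t\<le>d. monom (c t) t) s = (\<Sum>t\<le>d. c t * s ^ t)" for c :: "nat \<Rightarrow> 'a::comm_ring_1"
  by (simp add: poly_sum poly_monom)

lemma degree_sum_monom_le: "degree (\<Sum>t\<le>d. monom (c t) t) \<le> d"
  by (rule degree_sum_le) (auto intro: order.trans[OF degree_monom_le])

lemma coeff_sum_monom: "poly.coeff (\<Sum>t\<le>d. monom (c t) t) s = (if s \<le> d then c s else 0)"
  by (simp add: coeff_sum if_distrib cong: if_cong)

text \<open>Since \<open>d\<close> is below q, the expansion from \<open>apoly_expand\<close> is
  already the interpolating polynomial, so its degree bounds pass to
  \<open>fibre_coeff\<close>.\<close>

lemma fibre_coeff:
  fixes f :: "(nat \<Rightarrow> 'a::{field,finite}) \<Rightarrow> 'a"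
  assumes "apoly (Suc n) d f" and d_less: "d < CARD('a)"
  shows "t \<le> d \<Longrightarrow> apoly n (d - t) (fibre_coeff n t f)"
    and "t > d \<Longrightarrow> fibre_coeff n t f = 0"
    and "f x = (\<Sum>t\<le>d. fibre_coeff n t f x * x n ^ t)"
    and "degree (fibre_poly n f x) < CARD('a)"
    and "poly (fibre_poly n f x) s = f (x(n := s))"
proof -
  obtain c where c: "\<And>t. t \<le> d \<Longrightarrow> apoly n (d - t) (c t)"
      "\<And>x. f x = (\<Sum>t\<le>d. c t x * x n ^ t)"
    using apoly_expand[OF assms(1)] by blast
  have deg: "degree (\<Sum>t\<le>d. monom (c t x) t) < CARD('a)" for x
    using degree_sum_monom_le[of "\<lambda>t. c t x" d] d_less by simp
  have val: "poly (\<Sum>t\<le>d. monom (c t x) t) s = f (x(n := s))" for x s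
  proof -
    have "c t (x(n := s)) = c t x" if "t \<le> d" for t
      using that by (intro apoly_cong[OF c(1)]) auto
    then show ?thesis
      unfolding sum_monom_poly c(2) by (intro sum.cong) auto
  qed
  have eq: "fibre_poly n f x = (\<Sum>t\<le>d. monom (c t x) t)" for x
    using deg val by (rule fibre_poly_eqI)
  have coeff: "fibre_coeff n t f x = (if t \<le> d then c t x else 0)" for t x
    unfolding fibre_coeff_def eq coeff_sum_monom ..
  show "t \<le> d \<Longrightarrow> apoly n (d - t) (fibre_coeff n t f)"
    using c(1)[of t] unfolding coeff[abs_def] by simp
  show "t > d \<Longrightarrow> fibre_coeff n t f = 0"
    by (auto simp: coeff fun_eq_iff)
  show "f x = (\<Sum>t\<le>d. fibre_coeff n t f x * x n ^ t)"
    by (simp add: coeff c(2))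
  show "degree (fibre_poly n f x) < CARD('a)" "poly (fibre_poly n f x) s = f (x(n := s))"
    using deg val by (simp_all add: eq)
qed

lemma fibre_coeff_diff:
  fixes f g :: "(nat \<Rightarrow> 'a::{field,finite}) \<Rightarrow> 'a"
  assumes "apoly (Suc n) d f" "apoly (Suc n) d g" and "d < CARD('a)"
  shows "fibre_coeff n t (f - g) = fibre_coeff n t f - fibre_coeff n t g"
proof
  fix x :: "nat \<Rightarrow> 'a"
  have "fibre_poly n (f - g) x = fibre_poly n f x - fibre_poly n g x"
    using fibre_coeff(4,5)[OF assms(1,3), of x] fibre_coeff(4,5)[OF assms(2,3), of x]
    by (intro fibre_poly_eqI) (auto intro: le_less_trans[OF degree_diff_le_max])
  then show "fibre_coeff n t (f - g) x = (fibre_coeff n t f - fibre_coeff n t g) x"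
    by (simp add: fibre_coeff_def)
qed

section \<open>Supports of spaces of polynomial functions\<close>

definition pts :: "nat \<Rightarrow> (nat \<Rightarrow> 'a::zero) set" where
  "pts n = {x. \<forall>i\<ge>n. x i = 0}"

text \<open>The support of a subcode in the sense of coding theory, the complement of the common
  zeros. Its least size over subcodes of a given dimension is a generalized Hamming weight.\<close>

definition supp :: "nat \<Rightarrow> ((nat \<Rightarrow> 'a::zero) \<Rightarrow> 'b::zero) set \<Rightarrow> (nat \<Rightarrow> 'a) set" where
  "supp n U = {x \<in> pts n. \<exists>f\<in>U. f x \<noteq> 0}"

lemma pts_0: "pts 0 = {\<lambda>_. 0}"
  by (auto simp: pts_def)

lemma finite_pts: "finite (pts n :: (nat \<Rightarrow> 'a::{zero,finite}) set)"
proof -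
  have "finite {x :: nat \<Rightarrow> 'a. \<forall>i. (i \<in> {..<n} \<longrightarrow> x i \<in> UNIV) \<and> (i \<notin> {..<n} \<longrightarrow> x i = 0)}"
    by (intro finite_set_of_finite_funs) auto
  then show ?thesis
    by (rule rev_finite_subset) (auto simp: pts_def)
qed

lemma finite_supp: "finite (supp n U :: (nat \<Rightarrow> 'a::{zero,finite}) set)"
  unfolding supp_def by (rule finite_subset[OF _ finite_pts[of n]]) auto

lemma card_pts_Suc_filter:
  fixes P :: "(nat \<Rightarrow> 'a::{zero,finite}) \<Rightarrow> bool"
  shows "card {x \<in> pts (Suc n). P x} = (\<Sum>x\<in>pts n. card {s. P (x(n := s))})"
proof -
  have "bij_betw (\<lambda>(x, s). x(n := s)) (SIGMA x:pts n. {s. P (x(n := s))}) {x \<in> pts (Suc n). P x}"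
  proof (rule bij_betw_byWitness[where f' = "\<lambda>x. (x(n := 0), x n)"])
    show "\<forall>a\<in>SIGMA x:pts n. {s. P (x(n := s))}.
        (((case a of (x, s) \<Rightarrow> x(n := s)))(n := 0), (case a of (x, s) \<Rightarrow> x(n := s)) n) = a"
      by (auto simp: pts_def)
  qed (auto simp: pts_def Suc_le_eq)
  from bij_betw_same_card[OF this] show ?thesis
    by (simp add: finite_pts)
qed

lemma card_pts: "card (pts n :: (nat \<Rightarrow> 'a::{zero,finite}) set) = CARD('a) ^ n"
proof (induction n)
  case (Suc n)
  then show ?case
    using card_pts_Suc_filter[of n "\<lambda>_ :: nat \<Rightarrow> 'a. True"] by simp
qed (simp add: pts_0)

text \<open>Such a function depends on the first \<open>n\<close> coordinates only, so it is
  determined by its restriction to the finite set \<open>pts n\<close>.\<close>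

lemma finite_apoly: "finite {f :: (nat \<Rightarrow> 'a::{comm_ring_1,finite}) \<Rightarrow> 'a. apoly n d f}"
proof (rule finite_imageD)
  let ?r = "\<lambda>f :: (nat \<Rightarrow> 'a) \<Rightarrow> 'a. restrict f (pts n)"
  show "finite (?r ` {f. apoly n d f})"
  proof (rule finite_subset)
    show "?r ` {f. apoly n d f} \<subseteq> pts n \<rightarrow>\<^sub>E UNIV"
      by (auto simp: PiE_iff)
    show "finite (pts n \<rightarrow>\<^sub>E (UNIV :: 'a set) :: ((nat \<Rightarrow> 'a) \<Rightarrow> 'a) set)"
      by (rule finite_PiE[OF finite_pts]) (rule finite)
  qed
  show "inj_on ?r {f. apoly n d f}"
  proof (rule inj_onI)
    fix f g :: "(nat \<Rightarrow> 'a) \<Rightarrow> 'a"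
    assume f: "f \<in> {f. apoly n d f}" and g: "g \<in> {f. apoly n d f}" and eq: "?r f = ?r g"
    show "f = g"
    proof
      fix x :: "nat \<Rightarrow> 'a"
      let ?y = "\<lambda>i. if i < n then x i else 0"
      have "f x = f ?y" "g x = g ?y"
        using f g apoly_cong[of n d f x ?y] apoly_cong[of n d g x ?y] by simp_all
      moreover have "?r f ?y = ?r g ?y"
        unfolding eq ..
      moreover have "?y \<in> pts n"
        by (simp add: pts_def)
      ultimately show "f x = g x" by simp
    qed
  qed
qed

lemma apoly_0_const:
  assumes "apoly n 0 f"
  shows "f x = f y"
  using assms by (induction "0 :: nat" f rule: apoly.induct) auto

lemma card_const_funs_le:
  assumes "\<And>f. f \<in> U \<Longrightarrow> \<forall>x y. f x = (f y :: 'a::finite)"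
  shows "card U \<le> CARD('a)"
proof -
  have "inj_on (\<lambda>f. f undefined) U"
  proof (rule inj_onI)
    fix f g assume *: "f \<in> U" "g \<in> U" "f undefined = g undefined"
    show "f = g"
      using assms[OF *(1)] assms[OF *(2)] *(3) by (metis ext)
  qed
  then show ?thesis
    by (intro card_inj_on_le[of _ U UNIV]) auto
qed

section \<open>Slicing along the last variable\<close>

lemma fibre_coeff_0 [simp]: "fibre_coeff n t 0 = (0 :: (nat \<Rightarrow> 'a::{field,finite}) \<Rightarrow> 'a)"
proof
  fix x :: "nat \<Rightarrow> 'a"
  have "fibre_poly n 0 x = 0"
    by (rule fibre_poly_eqI) auto
  then show "fibre_coeff n t 0 x = (0 :: (nat \<Rightarrow> 'a) \<Rightarrow> 'a) x"
    by (simp add: fibre_coeff_def)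
qed

text \<open>An analogue of the ideals of leading coefficients in Hilbert's basis theorem. Members of
  degree below \<open>t\<close> contribute 0, so an additive group results when \<open>U\<close> is
  an \<open>apoly_space\<close>.\<close>

definition lead_coeffs ::
    "nat \<Rightarrow> ((nat \<Rightarrow> 'a::{field,finite}) \<Rightarrow> 'a) set \<Rightarrow> nat \<Rightarrow> ((nat \<Rightarrow> 'a) \<Rightarrow> 'a) set" where
  "lead_coeffs n U t = fibre_coeff n t ` {f \<in> U. \<forall>s>t. fibre_coeff n s f = 0}"

text \<open>A subcode of a Reed-Muller code, with scalar multiplication forgotten. Degrees below q
  are those in which \<open>fibre_coeff\<close> behaves well.\<close>

locale apoly_space =
  fixes n d :: nat and U :: "((nat \<Rightarrow> 'a::{field,finite}) \<Rightarrow> 'a) set"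
  assumes apoly: "f \<in> U \<Longrightarrow> apoly n d f"
    and subgroup: "additive_subgroup U"
    and degree_less: "d < CARD('a)"
begin

lemma finite: "finite U"
  by (rule finite_subset[OF _ finite_apoly[of n d]]) (use apoly in auto)

end

lemma apoly_space_lead_coeffs:
  assumes "apoly_space (Suc n) d U" "t \<le> d"
  shows "apoly_space n (d - t) (lead_coeffs n U t)"
proof -
  interpret apoly_space "Suc n" d U by fact
  have "additive_subgroup {f \<in> U. \<forall>s>t. fibre_coeff n s f = 0}"
    using subgroup apoly degree_less fibre_coeff_diff[of n d]
    unfolding additive_subgroup_def by (auto simp: fibre_coeff_diff[of n d])
  then have "additive_subgroup (lead_coeffs n U t)"
    unfolding lead_coeffs_def
    using apoly degree_less by (intro additive_subgroup_image) (auto simp: fibre_coeff_diff[of n d])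
  then show ?thesis
    using assms(2) degree_less fibre_coeff(1)[OF apoly degree_less]
    by unfold_locales (auto simp: lead_coeffs_def)
qed

text \<open>Filter \<open>U\<close> by the degree in the last variable. The successive quotients are
  the leading coefficient groups, and cardinalities multiply along the filtration.\<close>

lemma card_eq_prod_card_lead_coeffs:
  assumes "apoly_space (Suc n) d U"
  shows "card U = (\<Prod>t\<le>d. card (lead_coeffs n U t))"
proof -
  interpret apoly_space "Suc n" d U by fact
  \<comment> \<open>\<open>V t\<close> collects the members of degree below \<open>t\<close> in the
    last variable; the filtration runs from \<open>V 0 = {0}\<close> to
    \<open>V (Suc d) = U\<close>.\<close>
  define V where "V t = {f \<in> U. \<forall>s\<ge>t. fibre_coeff n s f = 0}" for t
  have fin: "finite (V t)" for t
    using finite by (simp add: V_def)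
  have sub: "additive_subgroup (V t)" for t
    using subgroup apoly degree_less
    unfolding additive_subgroup_def V_def by (auto simp: fibre_coeff_diff[of n d])
  have step: "card (V (Suc t)) = card (lead_coeffs n U t) * card (V t)" for t
  proof -
    have "card (V (Suc t)) = card (fibre_coeff n t ` V (Suc t)) *
        card {f \<in> V (Suc t). fibre_coeff n t f = 0}"
      using apoly degree_less
      by (intro card_eq_card_image_times_card_kernel sub fin)
        (auto simp: fibre_coeff_diff[of n d] V_def)
    moreover have "{f \<in> V (Suc t). fibre_coeff n t f = 0} = V t"
      unfolding V_def by (auto simp: Suc_le_eq) (metis le_eq_less_or_eq)
    ultimately show ?thesis
      by (simp add: lead_coeffs_def V_def Suc_le_eq)
  qed
  have "V 0 = {0}"
  proof -
    have "f = 0" if "f \<in> V 0" for f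
      using that fibre_coeff(3)[OF apoly degree_less, of f] by (auto simp: V_def fun_eq_iff)
    moreover have "0 \<in> V 0"
      using sub by (auto simp: additive_subgroup_def)
    ultimately show ?thesis by auto
  qed
  then have "card (V (Suc t)) = (\<Prod>s\<le>t. card (lead_coeffs n U s))" for t
    by (induction t) (simp_all add: step mult.commute)
  moreover have "V (Suc d) = U"
    using fibre_coeff(2)[OF apoly degree_less] by (auto simp: V_def Suc_le_eq)
  ultimately show ?thesis by metis
qed

text \<open>
  If \<open>x\<close> is in the support of the leading coefficients in degree \<open>t\<close>, then some member of \<open>U\<close> has
  degree \<open>t\<close> on the line over \<open>x\<close>, hence at least \<open>q - t\<close> nonzeros there.
\<close>

lemma sum_card_supp_lead_coeffs_le:
  fixes U :: "((nat \<Rightarrow> 'a::{field,finite}) \<Rightarrow> 'a) set"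
  assumes "apoly_space (Suc n) d U"
  shows "(\<Sum>s<CARD('a). card (\<Union>t\<le>s. supp n (lead_coeffs n U t))) \<le> card (supp (Suc n) U)"
proof -
  interpret apoly_space "Suc n" d U by fact
  let ?N = "\<lambda>t. supp n (lead_coeffs n U t)"
  have pointwise: "card {s. s < CARD('a) \<and> (\<exists>t\<le>s. x \<in> ?N t)} \<le> card {s. \<exists>f\<in>U. f (x(n := s)) \<noteq> 0}"
    for x
  proof (cases "\<exists>t. x \<in> ?N t")
    case True
    define t where "t = (LEAST t. x \<in> ?N t)"
    have "x \<in> ?N t"
      unfolding t_def using True by (rule LeastI_ex)
    then obtain f where f: "f \<in> U" "\<And>s. s > t \<Longrightarrow> fibre_coeff n s f x = 0" "fibre_coeff n t f x \<noteq> 0"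
      by (auto simp: supp_def lead_coeffs_def)
    define p where "p = fibre_poly n f x"
    have "p \<noteq> 0"
      using f(3) by (auto simp: fibre_coeff_def p_def)
    have "degree p \<le> t"
      using f(2) by (intro degree_le) (auto simp: fibre_coeff_def p_def)
    have "{s. s < CARD('a) \<and> (\<exists>t\<le>s. x \<in> ?N t)} \<subseteq> {t..<CARD('a)}"
      unfolding t_def by (auto intro: order.trans[OF Least_le])
    from card_mono[OF _ this] have "card {s. s < CARD('a) \<and> (\<exists>t\<le>s. x \<in> ?N t)} \<le> CARD('a) - t"
      by simp
    also have "\<dots> \<le> CARD('a) - card {s. poly p s = 0}"
      using card_poly_roots_bound[OF \<open>p \<noteq> 0\<close>] \<open>degree p \<le> t\<close> by linarith
    also have "\<dots> = card {s. poly p s \<noteq> 0}"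
      by (subst card_Diff_subset[symmetric]) (auto intro!: arg_cong[of _ _ card])
    also have "\<dots> \<le> card {s. \<exists>f\<in>U. f (x(n := s)) \<noteq> 0}"
      using f(1) fibre_coeff(5)[OF apoly[OF f(1)] degree_less, of x]
      by (intro card_mono) (auto simp: p_def)
    finally show ?thesis .
  qed simp
  \<comment> \<open>If \<open>t\<close> is the least index whose slice contains \<open>x\<close>,
    then \<open>x\<close> is counted for the q - t values of \<open>s\<close> from \<open>t\<close>
    to q - 1. Exchanging the sums makes the pointwise bound applicable.\<close>
  have "(\<Sum>s<CARD('a). card (\<Union>t\<le>s. ?N t)) =
      (\<Sum>s<CARD('a). \<Sum>x\<in>pts n. if \<exists>t\<le>s. x \<in> ?N t then 1 else 0)"
  proof (rule sum.cong)
    fix s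
    have "(\<Union>t\<le>s. ?N t) = {x \<in> pts n. \<exists>t\<le>s. x \<in> ?N t}"
      by (auto simp: supp_def)
    then show "card (\<Union>t\<le>s. ?N t) = (\<Sum>x\<in>pts n. if \<exists>t\<le>s. x \<in> ?N t then 1 else 0)"
      using finite_pts[where 'a = 'a, of n] by (simp add: sum.If_cases Int_def)
  qed simp
  also have "\<dots> = (\<Sum>x\<in>pts n. \<Sum>s<CARD('a). if \<exists>t\<le>s. x \<in> ?N t then 1 else 0)"
    by (rule sum.swap)
  also have "\<dots> = (\<Sum>x\<in>pts n. card {s. s < CARD('a) \<and> (\<exists>t\<le>s. x \<in> ?N t)})"
    by (intro sum.cong) (simp_all add: sum.If_cases Int_def)
  also have "\<dots> \<le> (\<Sum>x\<in>pts n. card {s. \<exists>f\<in>U. f (x(n := s)) \<noteq> 0})"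
    by (intro sum_mono pointwise)
  also have "\<dots> = card (supp (Suc n) U)"
    unfolding supp_def by (rule card_pts_Suc_filter[symmetric])
  finally show ?thesis .
qed

text \<open>A monotone sequence is at least \<open>w a\<close> on the block from \<open>a\<close> to
  \<open>b\<close>, and likewise on the next two blocks; the terms before \<open>a\<close> are
  dropped.\<close>

lemma sum_ge_three_steps:
  fixes w :: "nat \<Rightarrow> nat"
  assumes "mono w" "a \<le> b" "b \<le> c" "c \<le> q"
  shows "(b - a) * w a + (c - b) * w b + (q - c) * w c \<le> (\<Sum>s<q. w s)"
proof -
  have block: "(j - i) * w i \<le> sum w {i..<j}" for i j
    using sum_bounded_below[of "{i..<j}" "w i" w] assms(1) by (auto simp: mono_def)
  have "sum w {a..<q} = sum w {a..<b} + sum w {b..<c} + sum w {c..<q}"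
    using assms by (simp add: sum.atLeastLessThan_concat)
  moreover have "sum w {a..<q} \<le> sum w {..<q}"
    by (intro sum_mono2) auto
  ultimately show ?thesis
    using block[of b a] block[of c b] block[of q c] by linarith
qed

text \<open>The unions of slices grow with the degree, so the three-step bound applies to them.
  Indices may coincide, which empties blocks; thus one or two slices are covered as well.\<close>

lemma card_supp_ge_three_slices:
  fixes U :: "((nat \<Rightarrow> 'a::{field,finite}) \<Rightarrow> 'a) set"
  assumes "apoly_space (Suc n) d U" and "a \<le> b" "b \<le> c" "c \<le> d"
  shows "(real b - a) * card (supp n (lead_coeffs n U a))
       + (real c - b) * card (supp n (lead_coeffs n U b))
       + (real CARD('a) - c) * card (supp n (lead_coeffs n U c)) \<le> card (supp (Suc n) U)"
proof -
  define w where "w s = card (\<Union>t\<le>s. supp n (lead_coeffs n U t))" for s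
  have cq: "c < CARD('a)"
    using assms by (simp add: apoly_space_def)
  have fin: "finite (\<Union>t\<le>s. supp n (lead_coeffs n U t))" for s
    using finite_supp by blast
  have le: "card (supp n (lead_coeffs n U t)) \<le> w t" for t
    unfolding w_def by (intro card_mono fin) auto
  have "mono w"
    unfolding w_def by (intro monoI card_mono fin) force
  then have "(b - a) * w a + (c - b) * w b + (CARD('a) - c) * w c \<le> card (supp (Suc n) U)"
    using sum_ge_three_steps[of w a b c "CARD('a)"] assms cq
      sum_card_supp_lead_coeffs_le[OF assms(1)] by (simp add: w_def)
  then have "(b - a) * card (supp n (lead_coeffs n U a)) + (c - b) * card (supp n (lead_coeffs n U b))
      + (CARD('a) - c) * card (supp n (lead_coeffs n U c)) \<le> card (supp (Suc n) U)"
    using mult_le_mono2[OF le, of "b - a" a] mult_le_mono2[OF le, of "c - b" b]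
      mult_le_mono2[OF le, of "CARD('a) - c" c] by linarith
  then have "real ((b - a) * card (supp n (lead_coeffs n U a)) + (c - b) * card (supp n (lead_coeffs n U b))
      + (CARD('a) - c) * card (supp n (lead_coeffs n U c))) \<le> real (card (supp (Suc n) U))"
    by (rule of_nat_mono)
  then show ?thesis
    using assms cq by (simp add: of_nat_diff)
qed

section \<open>Generalized Hamming weights of affine spaces of polynomial functions\<close>

text \<open>The degrees at which the filtration of \<open>U\<close> by degree in the last variable
  grows. Only they give factors other than 1 in the cardinality of \<open>U\<close>.\<close>

definition jumps :: "nat \<Rightarrow> nat \<Rightarrow> ((nat \<Rightarrow> 'a::{field,finite}) \<Rightarrow> 'a) set \<Rightarrow> nat set" where
  "jumps n d U = {t. t \<le> d \<and> lead_coeffs n U t \<noteq> {0}}"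

lemma finite_jumps: "finite (jumps n d U)"
  by (simp add: jumps_def)

lemma card_eq_prod_jumps:
  assumes "apoly_space (Suc n) d U"
  shows "card U = (\<Prod>t\<in>jumps n d U. card (lead_coeffs n U t))"
  unfolding card_eq_prod_card_lead_coeffs[OF assms]
  by (rule prod.mono_neutral_right) (auto simp: jumps_def)

lemma apoly_space_0_card_le:
  assumes "apoly_space n 0 (U :: ((nat \<Rightarrow> 'a::{field,finite}) \<Rightarrow> 'a) set)"
  shows "card U \<le> CARD('a)"
  using assms apoly_0_const unfolding apoly_space_def by (intro card_const_funs_le) blast

lemma apoly_space_no_vars_card_le:
  assumes "apoly_space 0 d (U :: ((nat \<Rightarrow> 'a::{field,finite}) \<Rightarrow> 'a) set)"
  shows "card U \<le> CARD('a)"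
  using assms apoly_cong[of 0 d] unfolding apoly_space_def by (intro card_const_funs_le) blast

lemma card_field_ge_2: "2 \<le> CARD('a::{field,finite})"
proof -
  have "card {0, 1 :: 'a} \<le> CARD('a)"
    by (intro card_mono) auto
  then show ?thesis by simp
qed

text \<open>The minimum distance of a Reed-Muller code, multiplied by q to avoid the exponent
  \<open>n - 1\<close> at \<open>n = 0\<close>. One nonzero slice suffices: induction bounds its
  support, and above each of its points lie at least q - t nonzeros.\<close>

theorem card_supp_ge_first:
  fixes U :: "((nat \<Rightarrow> 'a::{field,finite}) \<Rightarrow> 'a) set"
  assumes "apoly_space n d U" "U \<noteq> {0}"
  shows "(real CARD('a) - d) * real CARD('a) ^ n \<le> real CARD('a) * card (supp n U)"
  using assms
proof (induction n arbitrary: d U)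
  case 0
  interpret apoly_space 0 d U by fact
  obtain f where f: "f \<in> U" "f \<noteq> 0"
    using 0 subgroup unfolding additive_subgroup_def by blast
  then obtain x where "f x \<noteq> 0"
    by (auto simp: fun_eq_iff)
  moreover have "f x = f (\<lambda>_. 0)"
    by (rule apoly_cong[OF apoly[OF f(1)]]) auto
  ultimately have "supp 0 U = {\<lambda>_. 0}"
    using f by (auto simp: supp_def pts_0)
  then show ?case by simp
next
  case (Suc n)
  interpret apoly_space "Suc n" d U by fact
  let ?q = "real CARD('a)"
  have "card U \<noteq> 1"
    using Suc.prems(2) subgroup by (auto simp: card_1_singleton_iff additive_subgroup_def)
  then obtain t where t: "t \<in> jumps n d U"
    using card_eq_prod_jumps[OF Suc.prems(1)] by fastforce
  then have td: "t \<le> d" and ne: "lead_coeffs n U t \<noteq> {0}"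
    by (auto simp: jumps_def)
  define A where "A = real (card (supp n (lead_coeffs n U t)))"
  have IH: "(?q - (d - t)) * ?q ^ n \<le> ?q * A"
    using Suc.IH[OF apoly_space_lead_coeffs[OF Suc.prems(1) td] ne] td
    by (simp add: A_def of_nat_diff)
  have "(?q - t) * A \<le> card (supp (Suc n) U)"
    using card_supp_ge_three_slices[OF Suc.prems(1), of t t t] td by (simp add: A_def)
  then have "?q * ((?q - t) * A) \<le> ?q * card (supp (Suc n) U)"
    by (intro mult_left_mono) auto
  moreover have "(?q - t) * ((?q - (d - t)) * ?q ^ n) \<le> (?q - t) * (?q * A)"
    using td degree_less by (intro mult_left_mono IH) auto
  moreover have "(?q - d) * ?q * ?q ^ n \<le> (?q - t) * (?q - (d - t)) * ?q ^ n"
  proof (rule mult_right_mono)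
    \<comment> \<open>This product is the difference of the two sides of the inequality
      below.\<close>
    have "real t * (d - t) \<ge> 0"
      by simp
    then show "(?q - d) * ?q \<le> (?q - t) * (?q - (d - t))"
      using td by (simp add: of_nat_diff algebra_simps)
  qed simp
  ultimately show ?case
    by (simp add: algebra_simps)
qed

text \<open>The right side exceeds the left by
  \<open>a * (d - b) + (b - a - 1) * (q - 1 - (b - a))\<close>, a sum of nonnegative terms.\<close>

lemma two_jumps_arith:
  fixes q a b d :: real
  assumes "a + 1 \<le> b" "b \<le> d" "d + 1 \<le> q" "0 \<le> a"
  shows "q * (q - d) + q - 1 \<le> (b - a) * (q - d + a) + (q - b) * (q - d + b)"
proof -
  have "0 \<le> a * (d - b)" "0 \<le> (b - a - 1) * (q - 1 - (b - a))"
    using assms by auto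
  then show ?thesis by (simp add: algebra_simps)
qed

text \<open>Inserting \<open>b\<close> between \<open>a\<close> and \<open>c\<close> raises the
  two-step sum by \<open>(c - b) * (b - a)\<close>. This is at least 1, which is what the two-step
  bound lacks.\<close>

lemma three_jumps_arith:
  fixes q a b c d :: real
  assumes "a + 1 \<le> b" "b + 1 \<le> c" "c \<le> d" "d + 1 \<le> q" "0 \<le> a"
  shows "q * (q - d) + q \<le> (b - a) * (q - d + a) + (c - b) * (q - d + b) + (q - c) * (q - d + c)"
proof -
  have "1 * 1 \<le> (c - b) * (b - a)"
    using assms by (intro mult_mono) auto
  moreover have "q * (q - d) + q - 1 \<le> (c - a) * (q - d + a) + (q - c) * (q - d + c)"
    using assms by (intro two_jumps_arith) auto
  ultimately show ?thesis by (simp add: algebra_simps)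
qed

text \<open>\<open>A\<close>, \<open>B\<close> and \<open>C\<close> bound the slices in units of
  \<open>q ^ (n - 1)\<close>, so that only the coefficients remain to be compared.\<close>

lemma card_supp_ge_slices_scaled:
  fixes U :: "((nat \<Rightarrow> 'a::{field,finite}) \<Rightarrow> 'a) set" and A B C :: real
  assumes U: "apoly_space (Suc n) d U" and le: "a \<le> b" "b \<le> c" "c \<le> d"
    and A: "A * real CARD('a) ^ n \<le> real CARD('a) * card (supp n (lead_coeffs n U a))"
    and B: "B * real CARD('a) ^ n \<le> real CARD('a) * card (supp n (lead_coeffs n U b))"
    and C: "C * real CARD('a) ^ n \<le> real CARD('a) * card (supp n (lead_coeffs n U c))"
  shows "((real b - a) * A + (real c - b) * B + (real CARD('a) - c) * C) * real CARD('a) ^ n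
    \<le> real CARD('a) * card (supp (Suc n) U)"
proof -
  let ?q = "real CARD('a)"
  let ?s = "\<lambda>t. real (card (supp n (lead_coeffs n U t)))"
  have "c < CARD('a)"
    using U le by (simp add: apoly_space_def)
  then have "(real b - a) * (A * ?q ^ n) + (real c - b) * (B * ?q ^ n) + (?q - c) * (C * ?q ^ n)
      \<le> (real b - a) * (?q * ?s a) + (real c - b) * (?q * ?s b) + (?q - c) * (?q * ?s c)"
    using le by (intro add_mono mult_left_mono A B C) auto
  also have "\<dots> = ?q * ((real b - a) * ?s a + (real c - b) * ?s b + (?q - c) * ?s c)"
    by (simp add: algebra_simps)
  also have "\<dots> \<le> ?q * card (supp (Suc n) U)"
    using card_supp_ge_three_slices[OF U le] by (intro mult_left_mono) auto
  finally show ?thesis by (simp add: algebra_simps)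
qed

lemma card_supp_lead_coeffs_ge:
  fixes U :: "((nat \<Rightarrow> 'a::{field,finite}) \<Rightarrow> 'a) set"
  assumes "apoly_space (Suc n) d U" "t \<in> jumps n d U"
  shows "(real CARD('a) - d + t) * real CARD('a) ^ n
    \<le> real CARD('a) * card (supp n (lead_coeffs n U t))"
proof -
  have "t \<le> d" "lead_coeffs n U t \<noteq> {0}"
    using assms(2) by (auto simp: jumps_def)
  then show ?thesis
    using card_supp_ge_first[OF apoly_space_lead_coeffs[OF assms(1)], of t]
    by (simp add: of_nat_diff algebra_simps)
qed

section \<open>Bounds according to the number of nonzero slices\<close>

lemma card_supp_ge_two_jumps:
  fixes U :: "((nat \<Rightarrow> 'a::{field,finite}) \<Rightarrow> 'a) set"
  assumes U: "apoly_space (Suc n) d U" and "a \<in> jumps n d U" "b \<in> jumps n d U" "a < b"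
  shows "(real CARD('a) * (real CARD('a) - d) + real CARD('a) - 1) * real CARD('a) ^ n
    \<le> real CARD('a) * card (supp (Suc n) U)"
proof -
  let ?q = "real CARD('a)"
  have le: "a \<le> b" "b \<le> d" "d < CARD('a)"
    using assms by (auto simp: jumps_def apoly_space_def)
  have "(?q * (?q - d) + ?q - 1) * ?q ^ n
      \<le> ((real b - a) * (?q - d + a) + (real b - b) * (?q - d + b) + (?q - b) * (?q - d + b)) * ?q ^ n"
    using two_jumps_arith[of a b d ?q] le \<open>a < b\<close> by (intro mult_right_mono) auto
  also have "\<dots> \<le> ?q * card (supp (Suc n) U)"
    using assms le by (intro card_supp_ge_slices_scaled[OF U]) (auto intro: card_supp_lead_coeffs_ge)
  finally show ?thesis .
qed

lemma card_supp_ge_three_jumps: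
  fixes U :: "((nat \<Rightarrow> 'a::{field,finite}) \<Rightarrow> 'a) set"
  assumes U: "apoly_space (Suc n) d U"
    and "a \<in> jumps n d U" "b \<in> jumps n d U" "c \<in> jumps n d U" "a < b" "b < c"
  shows "(real CARD('a) * (real CARD('a) - d) + real CARD('a)) * real CARD('a) ^ n
    \<le> real CARD('a) * card (supp (Suc n) U)"
proof -
  let ?q = "real CARD('a)"
  have le: "a \<le> b" "b \<le> c" "c \<le> d" "d < CARD('a)"
    using assms by (auto simp: jumps_def apoly_space_def)
  have "(?q * (?q - d) + ?q) * ?q ^ n
      \<le> ((real b - a) * (?q - d + a) + (real c - b) * (?q - d + b) + (?q - c) * (?q - d + c)) * ?q ^ n"
    using three_jumps_arith[of a b c d ?q] le \<open>a < b\<close> \<open>b < c\<close> by (intro mult_right_mono) auto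
  also have "\<dots> \<le> ?q * card (supp (Suc n) U)"
    using assms le by (intro card_supp_ge_slices_scaled[OF U]) (auto intro: card_supp_lead_coeffs_ge)
  finally show ?thesis .
qed

lemma jumps_ne:
  assumes "apoly_space (Suc n) d U" "1 < card U"
  shows "jumps n d U \<noteq> {}"
  using card_eq_prod_jumps[OF assms(1)] assms(2) by auto

text \<open>The product formula decides how large the slices are: a single one is as large as
  \<open>U\<close>, and two have cardinalities with product \<open>card U\<close>. Of three or more,
  the least, the greatest and one in between are picked.\<close>

lemma jumps_cases:
  assumes U: "apoly_space (Suc n) d U" "1 < card U"
  obtains (one) t where "t \<in> jumps n d U" "card (lead_coeffs n U t) = card U"
  | (two) a b where "jumps n d U = {a, b}" "a < b"
      "card (lead_coeffs n U a) * card (lead_coeffs n U b) = card U"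
  | (three) a b c where "a \<in> jumps n d U" "b \<in> jumps n d U" "c \<in> jumps n d U" "a < b" "b < c"
proof -
  let ?J = "jumps n d U"
  note prod = card_eq_prod_jumps[OF U(1)]
  have fin: "finite ?J" by (rule finite_jumps)
  define a where "a = Min ?J"
  define c where "c = Max ?J"
  have a: "a \<in> ?J" and c: "c \<in> ?J"
    using jumps_ne[OF U] fin by (auto simp: a_def c_def)
  have between: "a \<le> b \<and> b \<le> c" if "b \<in> ?J" for b
    using that fin by (auto simp: a_def c_def)
  consider "a = c" | "a < c" "?J \<subseteq> {a, c}" | b where "b \<in> ?J" "a < b" "b < c"
    using between by (metis insert_iff le_neq_implies_less c subsetI)
  then show thesis
  proof cases
    case 1
    then have "?J = {a}"
      using between a by force
    then show thesis
      using one[OF a] prod by simp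
  next
    case 2
    then have "?J = {a, c}"
      using a c by auto
    then show thesis
      using two[of a c] prod \<open>a < c\<close> by simp
  next
    case 3
    then show thesis
      using three a c by blast
  qed
qed

text \<open>The second generalized Hamming weight
  \<open>(q - d + 1) * q ^ (n - 1) - q ^ (n - 2)\<close>, multiplied by \<open>q ^ 2\<close>. Two
  jumps give exactly this from the minimum distances of the slices; a single jump leaves a slice as
  large as \<open>U\<close> in one variable less.\<close>

theorem card_supp_ge_second:
  fixes U :: "((nat \<Rightarrow> 'a::{field,finite}) \<Rightarrow> 'a) set"
  assumes "apoly_space n d U" "CARD('a) < card U"
  shows "(real CARD('a) - d + 1) * real CARD('a) ^ (n + 1)
    \<le> real CARD('a) ^ 2 * card (supp n U) + real CARD('a) ^ n"
  using assms
proof (induction n arbitrary: d U)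
  case 0
  then show ?case
    using apoly_space_no_vars_card_le[of d U] by simp
next
  case (Suc n)
  let ?q = "real CARD('a)"
  let ?Q = "?q ^ n"
  have q: "2 \<le> ?q"
    using card_field_ge_2[where 'a = 'a] by linarith
  have dq: "d < CARD('a)"
    using Suc.prems(1) by (simp add: apoly_space_def)
  have two_jumps: ?case if "a \<in> jumps n d U" "b \<in> jumps n d U" "a < b" for a b
  proof -
    have "?q * ((?q * (?q - d) + ?q - 1) * ?Q) \<le> ?q * (?q * card (supp (Suc n) U))"
      using card_supp_ge_two_jumps[OF Suc.prems(1) that] by (intro mult_left_mono) auto
    then show ?case
      by (simp add: algebra_simps power2_eq_square)
  qed
  have "1 < card U"
    using Suc.prems(2) card_field_ge_2[where 'a = 'a] by linarith
  with Suc.prems(1) show ?case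
  proof (cases rule: jumps_cases)
    case (one t)
    have td: "t \<le> d"
      using one by (auto simp: jumps_def)
    \<comment> \<open>In degree \<open>d\<close> the slice would consist of constants, of which
      there are only q.\<close>
    have "t \<noteq> d"
      using apoly_space_0_card_le[of n "lead_coeffs n U t"] one(2) Suc.prems(2)
        apoly_space_lead_coeffs[OF Suc.prems(1) td] by auto
    then have td: "t < d"
      using td by simp
    define A where "A = real (card (supp n (lead_coeffs n U t)))"
    have IH: "(?q - d + t + 1) * (?q * ?Q) - ?Q \<le> ?q ^ 2 * A"
      using Suc.IH[OF apoly_space_lead_coeffs[OF Suc.prems(1), of t]] one(2) Suc.prems(2) td
      by (simp add: A_def of_nat_diff algebra_simps)
    have "(?q - t) * A \<le> card (supp (Suc n) U)"
      using card_supp_ge_three_slices[OF Suc.prems(1), of t t t] td by (simp add: A_def)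
    then have "?q ^ 2 * ((?q - t) * A) \<le> ?q ^ 2 * card (supp (Suc n) U)"
      by (intro mult_left_mono) auto
    moreover have "(?q - t) * ((?q - d + t + 1) * (?q * ?Q) - ?Q) \<le> (?q - t) * (?q ^ 2 * A)"
      using td dq by (intro mult_left_mono IH) auto
    moreover have "((?q - d + 1) * ?q ^ 2 - ?q) * ?Q
        \<le> ((?q - t) * ((?q - d + t + 1) * ?q - 1)) * ?Q"
    proof (rule mult_right_mono)
      \<comment> \<open>Again the difference of the two sides, nonnegative because
        \<open>t < d\<close>.\<close>
      have "0 \<le> ?q * (t * (real d - 1 - t)) + t"
        using td by simp
      then show "(?q - d + 1) * ?q ^ 2 - ?q \<le> (?q - t) * ((?q - d + t + 1) * ?q - 1)"
        by (simp add: algebra_simps power2_eq_square)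
    qed simp
    ultimately show ?thesis
      by (simp add: algebra_simps power2_eq_square)
  next
    case (two a b)
    then show ?thesis using two_jumps[of a b] by simp
  next
    case (three a b c)
    then show ?thesis using two_jumps[of a b] by simp
  qed
qed

text \<open>In N = n + 1 variables this is the weight of order N + 1. In the induction step a
  nonzero slice is bounded by the first weight, one with more than q elements by the second, and one
  with more than \<open>q ^ (N - 1)\<close> elements by induction. With two jumps the first weight
  falls short by 1, which a larger slice must supply.\<close>

theorem card_supp_ge_third:
  fixes U :: "((nat \<Rightarrow> 'a::{field,finite}) \<Rightarrow> 'a) set"
  assumes "apoly_space (Suc n) d U" "CARD('a) ^ Suc n < card U"
  shows "(real CARD('a) - d + 1) * real CARD('a) ^ Suc n \<le> real CARD('a) * card (supp (Suc n) U)"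
  using assms
proof (induction n arbitrary: d U)
  case 0
  let ?q = "real CARD('a)"
  have dq: "d < CARD('a)"
    using "0.prems"(1) by (simp add: apoly_space_def)
  have q: "2 \<le> CARD('a)"
    by (rule card_field_ge_2)
  have two_jumps: ?case if "a \<in> jumps 0 d U" "b \<in> jumps 0 d U" "a < b" for a b
  proof -
    have "?q * (?q - d) + ?q - 1 \<le> ?q * card (supp (Suc 0) U)"
      using card_supp_ge_two_jumps[OF "0.prems"(1) that] by simp
    \<comment> \<open>The two-jump bound is 1 short of q times the claim. As the support has an
      integral number of points, exceeding q - d is enough.\<close>
    then have "?q * (?q - d) < ?q * card (supp (Suc 0) U)"
      using q by linarith
    then have "?q - d < card (supp (Suc 0) U)"
      using mult_left_mono[of "real (card (supp (Suc 0) U))" "?q - d" ?q] by linarith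
    then have "?q - d + 1 \<le> card (supp (Suc 0) U)"
      using dq by (simp flip: of_nat_diff)
    then show ?case
      using mult_left_mono[of "?q - d + 1" "real (card (supp (Suc 0) U))" ?q]
      by (simp add: mult.commute)
  qed
  have "1 < card U"
    using "0.prems"(2) q by simp
  with "0.prems"(1) show ?case
  proof (cases rule: jumps_cases)
    \<comment> \<open>Without variables a slice has at most q elements, so no single slice can be as
      large as \<open>U\<close>.\<close>
    case (one t)
    then show ?thesis
      using apoly_space_no_vars_card_le[OF apoly_space_lead_coeffs[OF "0.prems"(1), of t]] "0.prems"(2)
      by (simp add: jumps_def)
  next
    case (two a b)
    then show ?thesis using two_jumps[of a b] by simp
  next
    case (three a b c)
    then show ?thesis using two_jumps[of a b] by simp
  qed
next
  case (Suc n)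
  let ?q = "real CARD('a)"
  let ?Q = "?q ^ Suc n"
  let ?N = "lead_coeffs (Suc n) U"
  have q: "2 \<le> CARD('a)"
    by (rule card_field_ge_2)
  have dq: "d < CARD('a)"
    using Suc.prems(1) by (simp add: apoly_space_def)
  have q_le: "CARD('a) \<le> CARD('a) ^ Suc n"
    using q by simp
  have lead: "apoly_space (Suc n) (d - t) (?N t)" "(?q - d + t) * ?Q \<le> ?q * card (supp (Suc n) (?N t))"
    if "t \<in> jumps (Suc n) d U" for t
    using apoly_space_lead_coeffs[OF Suc.prems(1), of t] card_supp_lead_coeffs_ge[OF Suc.prems(1) that] that
    by (auto simp: jumps_def)
  \<comment> \<open>By induction a slice of this size gains a full unit over the minimum
    distance.\<close>
  have large: "t < d" "(?q - d + t + 1) * ?Q \<le> ?q * card (supp (Suc n) (?N t))"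
    if t: "t \<in> jumps (Suc n) d U" "CARD('a) ^ Suc n < card (?N t)" for t
  proof -
    have "t \<noteq> d"
      using apoly_space_0_card_le[of "Suc n" "?N t"] lead(1)[OF t(1)] t(2) q_le by auto
    then show "t < d"
      using t(1) by (auto simp: jumps_def)
    then show "(?q - d + t + 1) * ?Q \<le> ?q * card (supp (Suc n) (?N t))"
      using Suc.IH[OF lead(1)[OF t(1)] t(2)] by (simp add: of_nat_diff algebra_simps)
  qed
  \<comment> \<open>Here the second weight gains 1 - 1/q over the minimum distance.\<close>
  have medium: "(?q - d + t + 1 - 1 / ?q) * ?Q \<le> ?q * card (supp (Suc n) (?N t))"
    if t: "t \<in> jumps (Suc n) d U" "CARD('a) < card (?N t)" for t
  proof -
    have "?q * ((?q - d + t + 1 - 1 / ?q) * ?Q) = (?q - d + t + 1) * ?q ^ (Suc n + 1) - ?Q"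
      using q by (simp add: field_simps)
    also have "\<dots> \<le> ?q * (?q * card (supp (Suc n) (?N t)))"
      using card_supp_ge_second[OF lead(1)[OF t(1)] t(2)] t(1)
      by (simp add: of_nat_diff jumps_def power2_eq_square algebra_simps)
    finally show ?thesis
      using q by simp
  qed
  have suffices: ?case if "?q * (?q - d) + ?q \<le> C" "C * ?Q \<le> ?q * card (supp (Suc (Suc n)) U)" for C
  proof -
    have "(?q - d + 1) * ?q ^ Suc (Suc n) = (?q * (?q - d) + ?q) * ?Q"
      by (simp add: algebra_simps)
    also have "\<dots> \<le> C * ?Q"
      using that(1) by (intro mult_right_mono) auto
    also note that(2)
    finally show ?case .
  qed
  have "1 < card U"
    using Suc.prems(2) one_le_power[of "CARD('a)" "Suc (Suc n)"] q by linarith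
  with Suc.prems(1) show ?case
  proof (cases rule: jumps_cases)
    case (one t)
    have "CARD('a) ^ Suc n \<le> CARD('a) ^ Suc (Suc n)"
      using q by (intro power_increasing) auto
    then have *: "CARD('a) ^ Suc n < card (?N t)"
      using one(2) Suc.prems(2) by linarith
    note t = large[OF one(1) *]
    show ?thesis
    proof (rule suffices)
      \<comment> \<open>The difference of the two sides once more; a large slice has
        \<open>t < d\<close>.\<close>
      have "0 \<le> t * (real d - 1 - t)"
        using t(1) by simp
      then show "?q * (?q - d) + ?q \<le> (real t - t) * (?q - d + t + 1)
          + (real t - t) * (?q - d + t + 1) + (?q - t) * (?q - d + t + 1)"
        by (simp add: algebra_simps)
    qed (use t in \<open>intro card_supp_ge_slices_scaled[OF Suc.prems(1)], auto\<close>)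
  next
    case (two a b)
    have ab: "a \<in> jumps (Suc n) d U" "b \<in> jumps (Suc n) d U" "b \<le> d"
      using two(1) by (auto simp: jumps_def)
    have base: "?q * (?q - d) + ?q - 1 \<le> (real b - a) * (?q - d + a) + (?q - b) * (?q - d + b)"
      using two_jumps_arith[of a b d ?q] ab(3) dq two(2) by auto
    \<comment> \<open>The cardinalities of the slices have a product above
      \<open>q ^ (n + 2)\<close>, so if one is at most q, the other exceeds
      \<open>q ^ (n + 1)\<close>.\<close>
    have other: "CARD('a) ^ Suc n < k" if "l \<le> CARD('a)" "l * k = card U" for k l
    proof (rule ccontr)
      assume "\<not> CARD('a) ^ Suc n < k"
      then have "l * k \<le> CARD('a) * CARD('a) ^ Suc n"
        using that(1) by (intro mult_le_mono) auto
      then show False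
        using that(2) Suc.prems(2) by simp
    qed
    \<comment> \<open>The missing 1 comes from one large slice in the first two cases, and in the
      third from two gains that are at least 1/2 each because q is at least 2.\<close>
    consider "card (?N a) \<le> CARD('a)" | "card (?N b) \<le> CARD('a)"
      | "CARD('a) < card (?N a)" "CARD('a) < card (?N b)"
      by linarith
    then show ?thesis
    proof cases
      case 1
      note b = large[OF ab(2) other[OF 1 two(3)]]
      show ?thesis
      proof (rule suffices)
        show "?q * (?q - d) + ?q \<le> (real b - a) * (?q - d + a)
            + (real b - b) * (?q - d + b + 1) + (?q - b) * (?q - d + b + 1)"
          using base b(1) dq by (simp add: algebra_simps)
      qed (use b lead(2) ab two(2) in \<open>intro card_supp_ge_slices_scaled[OF Suc.prems(1)], auto\<close>)
    next
      case 2
      note a = large[OF ab(1) other[OF 2, of "card (?N a)"]]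
      have "card (?N b) * card (?N a) = card U"
        using two(3) by (simp add: mult.commute)
      note a = a[OF this]
      show ?thesis
      proof (rule suffices)
        show "?q * (?q - d) + ?q \<le> (real b - a) * (?q - d + a + 1)
            + (real b - b) * (?q - d + b) + (?q - b) * (?q - d + b)"
          using base two(2) by (simp add: algebra_simps)
      qed (use a lead(2) ab two(2) in \<open>intro card_supp_ge_slices_scaled[OF Suc.prems(1)], auto\<close>)
    next
      case 3
      show ?thesis
      proof (rule suffices)
        have "1 * (1 / 2) \<le> (real b - a) * (1 - 1 / ?q)"
          using two(2) q by (intro mult_mono) (auto simp: field_simps)
        moreover have "1 * (1 / 2) \<le> (?q - b) * (1 - 1 / ?q)"
          using ab(3) dq q by (intro mult_mono) (auto simp: field_simps)
        moreover have "(real b - a) * (?q - d + a + 1 - 1 / ?q)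
            + (real b - b) * (?q - d + b + 1 - 1 / ?q) + (?q - b) * (?q - d + b + 1 - 1 / ?q)
            = (real b - a) * (?q - d + a) + (real b - a) * (1 - 1 / ?q)
            + ((?q - b) * (?q - d + b) + (?q - b) * (1 - 1 / ?q))"
          by (simp add: algebra_simps)
        ultimately show "?q * (?q - d) + ?q \<le> (real b - a) * (?q - d + a + 1 - 1 / ?q)
            + (real b - b) * (?q - d + b + 1 - 1 / ?q) + (?q - b) * (?q - d + b + 1 - 1 / ?q)"
          using base by linarith
      qed (use medium[OF ab(1) 3(1)] medium[OF ab(2) 3(2)] ab two(2)
          in \<open>intro card_supp_ge_slices_scaled[OF Suc.prems(1)], auto\<close>)
    qed
  next
    case (three a b c)
    show ?thesis
      by (rule suffices[OF order.refl]) (use card_supp_ge_three_jumps[OF Suc.prems(1) three] in simp)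
  qed
qed

section \<open>Spaces of forms of degree \<open>q\<close>\<close>

text \<open>For \<open>c = 0\<close> this is restriction to a hyperplane through the origin, for
  \<open>c = 1\<close> to a parallel copy of it, which is an affine chart of the projective
  complement. Both are parametrized by the first \<open>n\<close> coordinates.\<close>

definition section_at ::
    "nat \<Rightarrow> (nat \<Rightarrow> 'a) \<Rightarrow> 'a \<Rightarrow> ((nat \<Rightarrow> 'a::comm_ring_1) \<Rightarrow> 'a) \<Rightarrow> (nat \<Rightarrow> 'a) \<Rightarrow> 'a" where
  "section_at n b c f = (\<lambda>x. f (x(n := c + (\<Sum>i<n. b i * x i))))"

locale hform_space =
  fixes n :: nat and W :: "((nat \<Rightarrow> 'a::{field,finite}) \<Rightarrow> 'a) set"
  assumes hform: "f \<in> W \<Longrightarrow> hform n CARD('a) f"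
    and subgroup: "additive_subgroup W"

lemma hform_imp_apoly: "hform n d f \<Longrightarrow> apoly n d f"
  by (induction rule: hform.induct) (auto intro: apoly.intros)

lemma (in hform_space) finite: "finite W"
  by (rule finite_subset[OF _ finite_apoly[of n "CARD('a)"]]) (use hform hform_imp_apoly in auto)

lemma section_at_diff: "section_at n b c (f - g) = section_at n b c f - section_at n b c g"
  by (auto simp: section_at_def)

lemma hform_space_section_at_0:
  assumes "hform_space (Suc n) W"
  shows "hform_space n (section_at n b 0 ` W)"
proof -
  interpret hform_space "Suc n" W by fact
  show ?thesis
    using subgroup hform hform_restrict[of n _ _ b]
    by unfold_locales (auto simp: section_at_diff section_at_def intro!: additive_subgroup_image)
qed

text \<open>After a shear the hyperplane is \<open>x n = 0\<close>. As \<open>f\<close> vanishes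
  there, subtracting its values on it changes nothing, yet it exhibits a function of degree one
  less.\<close>

lemma apoly_section_at_1:
  assumes "hform (Suc n) (Suc d) f" "section_at n b 0 f = 0"
  shows "apoly n d (section_at n b 1 f)"
proof -
  have "section_at n b 1 f = (\<lambda>x. section_at n b 1 f x - section_at n b 0 f x)"
    by (simp add: assms(2))
  moreover have "apoly n d (\<lambda>x. section_at n b 1 f x - section_at n b 0 f x)"
    using hform_dehomogenize_vanishing[OF hform_shear[OF assms(1), of b]]
    by (simp add: section_at_def cong: sum.cong_simp)
  ultimately show ?thesis by simp
qed

text \<open>Sort the vectors by the value \<open>c\<close> of
  \<open>x n - (\<Sum>i<n. b i * x i)\<close>. By homogeneity, multiplication by a nonzero
  \<open>c\<close> carries the support at value 1 onto that at value \<open>c\<close>, so the q - 1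
  nonzero values count the same.\<close>

lemma card_supp_eq_sections:
  fixes W :: "((nat \<Rightarrow> 'a::{field,finite}) \<Rightarrow> 'a) set"
  assumes W: "\<And>f. f \<in> W \<Longrightarrow> hform (Suc n) d f"
  shows "card (supp (Suc n) W) =
    card (supp n (section_at n b 0 ` W)) + (CARD('a) - 1) * card (supp n (section_at n b 1 ` W))"
proof -
  let ?l = "\<lambda>x :: nat \<Rightarrow> 'a. \<Sum>i<n. b i * x i"
  let ?S = "\<lambda>c. supp n (section_at n b c ` W)"
  have S: "?S c = {x \<in> pts n. \<exists>f\<in>W. f (x(n := c + ?l x)) \<noteq> 0}" for c
    by (auto simp: supp_def section_at_def)
  have "card (supp (Suc n) W) = (\<Sum>x\<in>pts n. card {s. \<exists>f\<in>W. f (x(n := s)) \<noteq> 0})"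
    unfolding supp_def by (rule card_pts_Suc_filter)
  also have "\<dots> = (\<Sum>x\<in>pts n. card {c. \<exists>f\<in>W. f (x(n := c + ?l x)) \<noteq> 0})"
  proof (rule sum.cong[OF refl])
    fix x :: "nat \<Rightarrow> 'a"
    have "bij_betw (\<lambda>s. s - ?l x) {s. \<exists>f\<in>W. f (x(n := s)) \<noteq> 0} {c. \<exists>f\<in>W. f (x(n := c + ?l x)) \<noteq> 0}"
      by (rule bij_betw_byWitness[where f' = "\<lambda>c. c + ?l x"]) auto
    then show "card {s. \<exists>f\<in>W. f (x(n := s)) \<noteq> 0} = card {c. \<exists>f\<in>W. f (x(n := c + ?l x)) \<noteq> 0}"
      by (rule bij_betw_same_card)
  qed
  also have "\<dots> = (\<Sum>x\<in>pts n. \<Sum>c\<in>UNIV. if \<exists>f\<in>W. f (x(n := c + ?l x)) \<noteq> 0 then 1 else 0)"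
    by (intro sum.cong) (simp_all add: sum.If_cases)
  also have "\<dots> = (\<Sum>c\<in>UNIV. \<Sum>x\<in>pts n. if \<exists>f\<in>W. f (x(n := c + ?l x)) \<noteq> 0 then 1 else 0)"
    by (rule sum.swap)
  also have "\<dots> = (\<Sum>c\<in>UNIV. card (?S c))"
    unfolding S using finite_pts[where 'a = 'a, of n]
    by (intro sum.cong) (simp_all add: sum.If_cases Int_def)
  also have "\<dots> = card (?S 0) + (\<Sum>c\<in>UNIV - {0}. card (?S c))"
    by (rule sum.remove) auto
  also have "(\<Sum>c\<in>UNIV - {0}. card (?S c)) = (\<Sum>c\<in>UNIV - {0 :: 'a}. card (?S 1))"
  proof (rule sum.cong[OF refl])
    fix c :: 'a assume c: "c \<in> UNIV - {0}"
    have scale: "f ((\<lambda>i. e * x i)(n := e * k + ?l (\<lambda>i. e * x i))) = e ^ d * f (x(n := k + ?l x))"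
      if "f \<in> W" for f e k x
    proof -
      have "(\<lambda>i. e * x i)(n := e * k + ?l (\<lambda>i. e * x i)) = (\<lambda>i. e * (x(n := k + ?l x)) i)"
        by (auto simp: sum_distrib_left algebra_simps)
      then show ?thesis
        using hform_scale[OF W[OF that], of e "x(n := k + ?l x)"] by (simp only:)
    qed
    have mem: "(\<lambda>i. e * x i) \<in> ?S (e * k)" if "x \<in> ?S k" "e \<noteq> 0" for e k x
    proof -
      obtain f where f: "f \<in> W" "f (x(n := k + ?l x)) \<noteq> 0"
        using \<open>x \<in> ?S k\<close> unfolding S by blast
      have "f ((\<lambda>i. e * x i)(n := e * k + ?l (\<lambda>i. e * x i))) \<noteq> 0"
        unfolding scale[OF f(1)] using f(2) \<open>e \<noteq> 0\<close> by simp
      moreover have "(\<lambda>i. e * x i) \<in> pts n"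
        using \<open>x \<in> ?S k\<close> by (simp add: S pts_def)
      ultimately show ?thesis
        using f(1) unfolding S by blast
    qed
    have "bij_betw (\<lambda>x i. c * x i) (?S 1) (?S c)"
    proof (rule bij_betw_byWitness[where f' = "\<lambda>x i. inverse c * x i"])
      show "(\<lambda>x i. c * x i) ` ?S 1 \<subseteq> ?S c"
        using mem[of _ 1 c] c by auto
      show "(\<lambda>x i. inverse c * x i) ` ?S c \<subseteq> ?S 1"
        using mem[of _ c "inverse c"] c by auto
      show "\<forall>x\<in>?S 1. (\<lambda>i. inverse c * (c * x i)) = x" "\<forall>x\<in>?S c. (\<lambda>i. c * (inverse c * x i)) = x"
        using c by (simp_all add: fun_eq_iff mult.assoc[symmetric])
    qed
    then show "card (?S c) = card (?S 1)"
      by (rule bij_betw_same_card[symmetric])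
  qed
  finally show ?thesis
    by (simp add: card_Diff_singleton)
qed

text \<open>Since \<open>x j\<close> is nonzero, \<open>b j\<close> is determined by the other
  coordinates of \<open>b\<close>. Overwriting it by an arbitrary value is therefore
  injective.\<close>

lemma card_dot_eq_le:
  fixes x :: "nat \<Rightarrow> 'a::{field,finite}"
  assumes "j < n" "x j \<noteq> 0"
  shows "CARD('a) * card {b \<in> pts n. (\<Sum>i<n. b i * x i) = s} \<le> CARD('a) ^ n"
proof -
  let ?B = "{b \<in> pts n. (\<Sum>i<n. b i * x i) = s}"
  have split: "(\<Sum>i<n. b i * x i) = b j * x j + (\<Sum>i\<in>{..<n} - {j}. b i * x i)" for b
    using assms(1) by (intro sum.remove) auto
  have "inj_on (\<lambda>(u, b). b(j := u)) (UNIV \<times> ?B)"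
  proof (intro inj_onI, clarify)
    fix u b u' b'
    assume b: "b \<in> pts n" "b' \<in> pts n" and sums: "(\<Sum>i<n. b' i * x i) = (\<Sum>i<n. b i * x i)"
      and eq: "b(j := u) = b'(j := u')"
    have off: "b i = b' i" if "i \<noteq> j" for i
      using fun_cong[OF eq, of i] that by simp
    then have "(\<Sum>i\<in>{..<n} - {j}. b i * x i) = (\<Sum>i\<in>{..<n} - {j}. b' i * x i)"
      by (intro sum.cong) auto
    then have "b j = b' j"
      using sums assms(2) by (simp add: split)
    then show "u = u' \<and> b = b'"
      using off fun_cong[OF eq, of j] by (metis ext fun_upd_same)
  qed
  moreover have "(\<lambda>(u, b). b(j := u)) ` (UNIV \<times> ?B) \<subseteq> pts n"
    using assms(1) by (auto simp: pts_def)
  ultimately have "card ((UNIV :: 'a set) \<times> ?B) \<le> card (pts n :: (nat \<Rightarrow> 'a) set)"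
    using finite_pts by (rule card_inj_on_le)
  then show ?thesis
    by (simp add: card_cartesian_product card_pts)
qed

text \<open>
  Every point other than \<open>(0:\<dots>:0:1)\<close> lies on the same proportion \<open>1/q\<close> of the hyperplanes
  \<open>X\<^sub>n = b\<^sub>0 X\<^sub>0 + \<dots> + b\<^sub>n\<^sub>-\<^sub>1 X\<^sub>n\<^sub>-\<^sub>1\<close>.
\<close>

lemma card_supp_ge_if_sections_ge:
  fixes W :: "((nat \<Rightarrow> 'a::{field,finite}) \<Rightarrow> 'a) set" and K :: real
  assumes zero: "\<And>f. f \<in> W \<Longrightarrow> f (\<lambda>_. 0) = 0"
    and K: "\<And>b. b \<in> pts n \<Longrightarrow> K \<le> card (supp n (section_at n b 0 ` W))"
  shows "real CARD('a) * K \<le> card (supp (Suc n) W)"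
proof -
  let ?P = "\<lambda>x. \<exists>f\<in>W. f x \<noteq> 0"
  let ?l = "\<lambda>b x. \<Sum>i<n. b i * x i :: 'a"
  have each: "CARD('a) * card {b \<in> pts n. ?P (x(n := ?l b x))} \<le> CARD('a) ^ n * card {s. ?P (x(n := s))}"
    if x: "x \<in> pts n" for x
  proof (cases "\<exists>j<n. x j \<noteq> 0")
    case True
    then obtain j where j: "j < n" "x j \<noteq> 0" by blast
    have "{b \<in> pts n. ?P (x(n := ?l b x))} = (\<Union>s\<in>{s. ?P (x(n := s))}. {b \<in> pts n. ?l b x = s})"
      by auto
    then have "CARD('a) * card {b \<in> pts n. ?P (x(n := ?l b x))}
        \<le> CARD('a) * (\<Sum>s\<in>{s. ?P (x(n := s))}. card {b \<in> pts n. ?l b x = s})"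
      by (simp only: card_UN_le finite mult_le_mono2)
    also have "\<dots> = (\<Sum>s\<in>{s. ?P (x(n := s))}. CARD('a) * card {b \<in> pts n. ?l b x = s})"
      by (rule sum_distrib_left)
    also have "\<dots> \<le> (\<Sum>s\<in>{s. ?P (x(n := s))}. CARD('a) ^ n)"
      by (intro sum_mono card_dot_eq_le[where j = j and x = x] j)
    finally show ?thesis by (simp add: mult.commute)
  next
    \<comment> \<open>Above \<open>x = 0\<close> each of the hyperplanes contains only the origin,
      where \<open>W\<close> vanishes.\<close>
    case False
    then have "x = (\<lambda>_. 0)"
      using x by (auto simp: pts_def fun_eq_iff not_less)
    then have "x(n := ?l b x) = (\<lambda>_. 0)" for b
      by auto
    then have "{b \<in> pts n. ?P (x(n := ?l b x))} = {}"
      using zero by auto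
    then show ?thesis by (simp only: card.empty mult_0_right zero_le)
  qed
  \<comment> \<open>Double counting of the pairs of a hyperplane and a support point on it.\<close>
  have "real CARD('a) ^ n * K = (\<Sum>b\<in>(pts n :: (nat \<Rightarrow> 'a) set). K)"
    by (simp add: card_pts)
  also have "\<dots> \<le> (\<Sum>b\<in>(pts n :: (nat \<Rightarrow> 'a) set). real (card (supp n (section_at n b 0 ` W))))"
    by (intro sum_mono K)
  finally have "real CARD('a) ^ n * K \<le> (\<Sum>b\<in>(pts n :: (nat \<Rightarrow> 'a) set). card (supp n (section_at n b 0 ` W)))"
    by simp
  also have "(\<Sum>b\<in>(pts n :: (nat \<Rightarrow> 'a) set). card (supp n (section_at n b 0 ` W)))
      = (\<Sum>b\<in>pts n. \<Sum>x\<in>pts n. if ?P (x(n := ?l b x)) then 1 else 0)"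
  proof (rule sum.cong[OF refl])
    fix b :: "nat \<Rightarrow> 'a"
    have "supp n (section_at n b 0 ` W) = {x \<in> pts n. ?P (x(n := ?l b x))}"
      by (auto simp: supp_def section_at_def)
    then show "card (supp n (section_at n b 0 ` W)) = (\<Sum>x\<in>pts n. if ?P (x(n := ?l b x)) then 1 else 0)"
      using finite_pts[where 'a = 'a, of n] by (simp add: sum.If_cases Int_def)
  qed
  also have "\<dots> = (\<Sum>x\<in>pts n. \<Sum>b\<in>pts n. if ?P (x(n := ?l b x)) then 1 else 0)"
    by (rule sum.swap)
  also have "\<dots> = (\<Sum>x\<in>pts n. card {b \<in> pts n. ?P (x(n := ?l b x))})"
    using finite_pts[where 'a = 'a, of n]
    by (intro sum.cong) (simp_all add: sum.If_cases Int_def)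
  finally have "real CARD('a) * (real CARD('a) ^ n * K)
      \<le> real CARD('a) * (\<Sum>x\<in>pts n. card {b \<in> pts n. ?P (x(n := ?l b x))})"
    by (intro mult_left_mono) auto
  also have "\<dots> = (\<Sum>x\<in>pts n. CARD('a) * card {b \<in> pts n. ?P (x(n := ?l b x))})"
    by (simp add: sum_distrib_left)
  also have "\<dots> \<le> (\<Sum>x\<in>pts n. CARD('a) ^ n * card {s. ?P (x(n := s))})"
    by (intro of_nat_mono sum_mono each)
  also have "\<dots> = CARD('a) ^ n * card (supp (Suc n) W)"
    unfolding supp_def by (simp only: card_pts_Suc_filter sum_distrib_left)
  finally have "real CARD('a) ^ n * (real CARD('a) * K) \<le> real CARD('a) ^ n * card (supp (Suc n) W)"
    by (simp add: mult_ac)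
  then show ?thesis by simp
qed

section \<open>Restriction of a space of forms to a hyperplane and to its complement\<close>

lemma hform_zero_at_0:
  assumes "hform n d f" "d > 0"
  shows "f (\<lambda>_. 0) = 0"
  using hform_scale[OF assms(1), of 0] assms(2) by (simp add: zero_power)

lemma hform_eq_0_iff_supp_empty:
  fixes f :: "(nat \<Rightarrow> 'a::{field,finite}) \<Rightarrow> 'a"
  assumes "hform n d f"
  shows "supp n {f} = {} \<longleftrightarrow> f = 0"
proof
  assume empty: "supp n {f} = {}"
  show "f = 0"
  proof
    fix x
    have "f x = f (\<lambda>i. if i < n then x i else 0)"
      by (rule hform_cong[OF assms]) auto
    moreover have "(\<lambda>i. if i < n then x i else 0) \<in> pts n"
      by (simp add: pts_def)
    ultimately show "f x = 0 x"
      using empty by (auto simp: supp_def)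
  qed
qed (auto simp: supp_def)

text \<open>Together with one vector the support of \<open>f\<close> contains its q - 1 nonzero
  multiples.\<close>

lemma card_supp_cone_ge:
  fixes f :: "(nat \<Rightarrow> 'a::{field,finite}) \<Rightarrow> 'a"
  assumes "hform n d f" "d > 0" "f \<in> W" "f \<noteq> 0"
  shows "CARD('a) - 1 \<le> card (supp n W)"
proof -
  obtain x where x: "x \<in> pts n" "f x \<noteq> 0"
    using hform_eq_0_iff_supp_empty[OF assms(1)] assms(4) by (auto simp: supp_def)
  then have "x \<noteq> (\<lambda>_. 0)"
    using hform_zero_at_0[OF assms(1,2)] by auto
  then obtain j where j: "x j \<noteq> 0" by auto
  have "inj_on (\<lambda>c i. c * x i) (UNIV - {0})"
    using j by (intro inj_onI) (metis mult_cancel_right)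
  moreover have "(\<lambda>c i. c * x i) ` (UNIV - {0}) \<subseteq> supp n W"
    using x assms(3) hform_scale[OF assms(1)] by (force simp: supp_def pts_def)
  ultimately have "card (UNIV - {0 :: 'a}) \<le> card (supp n W)"
    using finite_supp by (rule card_inj_on_le)
  then show ?thesis
    by (simp add: card_Diff_singleton)
qed

lemma additive_subgroup_ne_zero:
  assumes "additive_subgroup W" "W \<noteq> {0}"
  obtains f where "f \<in> W" "f \<noteq> 0"
  using assms unfolding additive_subgroup_def by blast

lemma card_supp_ge_section_at_1:
  fixes W :: "((nat \<Rightarrow> 'a::{field,finite}) \<Rightarrow> 'a) set"
  assumes "hform_space (Suc n) W" "G \<subseteq> section_at n b 1 ` W"
  shows "real (card (supp n (section_at n b 0 ` W))) + (real CARD('a) - 1) * card (supp n G)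
    \<le> card (supp (Suc n) W)"
proof -
  interpret hform_space "Suc n" W by fact
  have "card (supp n G) \<le> card (supp n (section_at n b 1 ` W))"
    using assms(2) by (intro card_mono finite_supp) (auto simp: supp_def)
  then have "card (supp n (section_at n b 0 ` W)) + (CARD('a) - 1) * card (supp n G)
      \<le> card (supp (Suc n) W)"
    using card_supp_eq_sections[OF hform, of W b] by simp
  then have "real (card (supp n (section_at n b 0 ` W)) + (CARD('a) - 1) * card (supp n G))
      \<le> card (supp (Suc n) W)"
    by (rule of_nat_mono)
  then show ?thesis
    by (simp add: of_nat_diff)
qed

text \<open>A member of \<open>W\<close> vanishing on the hyperplane and on the chart is 0, because
  every vector off the hyperplane is a multiple of one in the chart. So the kernel of the
  restriction embeds into the functions of degree at most q - 1 on the chart.\<close>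

lemma hyperplane_kernel:
  fixes W :: "((nat \<Rightarrow> 'a::{field,finite}) \<Rightarrow> 'a) set" and b :: "nat \<Rightarrow> 'a"
  assumes "hform_space (Suc n) W"
  defines "K \<equiv> {f \<in> W. section_at n b 0 f = 0}"
  shows "apoly_space n (CARD('a) - 1) (section_at n b 1 ` K)"
    and "card W = card (section_at n b 0 ` W) * card (section_at n b 1 ` K)"
proof -
  interpret hform_space "Suc n" W by fact
  have deg: "CARD('a) = Suc (CARD('a) - 1)"
    by simp
  have K: "additive_subgroup K"
    unfolding K_def using subgroup by (intro additive_subgroup_kernel) (simp_all add: section_at_diff)
  show "apoly_space n (CARD('a) - 1) (section_at n b 1 ` K)"
  proof
    show "additive_subgroup (section_at n b 1 ` K)"
      using K by (intro additive_subgroup_image) (simp_all add: section_at_diff)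
    fix g assume "g \<in> section_at n b 1 ` K"
    then show "apoly n (CARD('a) - 1) g"
      using hform deg by (auto simp: K_def intro!: apoly_section_at_1)
  qed simp
  have "f = 0" if "f \<in> K" "section_at n b 1 f = 0" for f
  proof -
    have f: "hform (Suc n) CARD('a) f" "section_at n b 0 f = 0"
      using that hform by (auto simp: K_def)
    have "card (supp (Suc n) {f}) = 0"
      using card_supp_eq_sections[of "{f}" n "CARD('a)" b] f that by (simp add: supp_def)
    then show "f = 0"
      using hform_eq_0_iff_supp_empty[OF f(1)] card_0_eq[OF finite_supp, of "Suc n" "{f}"] by blast
  qed
  then have "inj_on (section_at n b 1) K"
    using K by (intro inj_onI)
      (metis additive_subgroup_def right_minus_eq section_at_diff)
  then show "card W = card (section_at n b 0 ` W) * card (section_at n b 1 ` K)"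
    using card_eq_card_image_times_card_kernel[OF subgroup finite, of "section_at n b 0"]
    by (simp add: card_image section_at_diff K_def)
qed

text \<open>Either \<open>W\<close> is nonzero on all hyperplanes of the given shape and averaging
  reproduces the bound, or it vanishes on one of them and the minimum distance in degree q - 1
  applies on the complement. In projective points the bound is \<open>q ^ (n - 1)\<close>.\<close>

theorem card_supp_hform_space_ge_first:
  fixes W :: "((nat \<Rightarrow> 'a::{field,finite}) \<Rightarrow> 'a) set"
  assumes "hform_space (Suc n) W" "W \<noteq> {0}"
  shows "(real CARD('a) - 1) * real CARD('a) ^ n \<le> real CARD('a) * card (supp (Suc n) W)"
  using assms
proof (induction n arbitrary: W)
  case 0
  interpret hform_space "Suc 0" W by fact
  obtain f where f: "f \<in> W" "f \<noteq> 0"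
    using additive_subgroup_ne_zero[OF subgroup "0.prems"(2)] .
  have "real CARD('a) - 1 \<le> card (supp (Suc 0) W)"
    using card_supp_cone_ge[OF hform[OF f(1)] _ f] by (simp add: of_nat_diff)
  then show ?case
    using mult_mono[of 1 "real CARD('a)" "real CARD('a) - 1" "card (supp (Suc 0) W)"] by simp
next
  case (Suc n)
  interpret hform_space "Suc (Suc n)" W by fact
  let ?q = "real CARD('a)"
  have q: "2 \<le> ?q"
    using card_field_ge_2[where 'a = 'a] by linarith
  show ?case
  proof (cases "\<forall>b\<in>pts (Suc n). section_at (Suc n) b 0 ` W \<noteq> {0}")
    case True
    have "?q * ((?q - 1) * ?q ^ n / ?q) \<le> card (supp (Suc (Suc n)) W)"
    proof (rule card_supp_ge_if_sections_ge)
      show "f (\<lambda>_. 0) = 0" if "f \<in> W" for f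
        using hform_zero_at_0[OF hform[OF that]] by simp
      show "(?q - 1) * ?q ^ n / ?q \<le> card (supp (Suc n) (section_at (Suc n) b 0 ` W))"
        if "b \<in> pts (Suc n)" for b
        using Suc.IH[OF hform_space_section_at_0[OF Suc.prems(1)] True[rule_format, OF that]] q
        by (simp add: divide_le_eq mult.commute)
    qed
    then have "?q * ((?q - 1) * ?q ^ n) \<le> ?q * card (supp (Suc (Suc n)) W)"
      using q by simp
    then show ?thesis by (simp add: mult_ac)
  next
    case False
    then obtain b where b: "section_at (Suc n) b 0 ` W = {0}" by blast
    define G where "G = section_at (Suc n) b 1 ` {f \<in> W. section_at (Suc n) b 0 f = 0}"
    note kernel = hyperplane_kernel[OF Suc.prems(1), of b, folded G_def]
    have "card W \<noteq> 1"
      using Suc.prems(2) subgroup by (auto simp: card_1_singleton_iff additive_subgroup_def)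
    then have "G \<noteq> {0}"
      using kernel(2) b by auto
    then have "?q ^ Suc n \<le> ?q * card (supp (Suc n) G)"
      using card_supp_ge_first[OF kernel(1)] by (simp add: of_nat_diff)
    then have "(?q - 1) * ?q ^ Suc n \<le> (?q - 1) * (?q * card (supp (Suc n) G))"
      using q by (intro mult_left_mono) auto
    moreover have "G \<subseteq> section_at (Suc n) b 1 ` W"
      by (auto simp: G_def)
    from card_supp_ge_section_at_1[OF Suc.prems(1) this]
    have "(?q - 1) * card (supp (Suc n) G) \<le> card (supp (Suc (Suc n)) W)"
      by linarith
    then have "?q * ((?q - 1) * card (supp (Suc n) G)) \<le> ?q * card (supp (Suc (Suc n)) W)"
      by (intro mult_left_mono) auto
    ultimately show ?thesis
      by (simp only: mult_ac)
  qed
qed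

text \<open>In projective points the bound is \<open>2 * q ^ (n - 1)\<close>. If all hyperplane
  restrictions stay large, averaging suffices. If one is zero, the chart carries all of
  \<open>W\<close> and \<open>card_supp_ge_third\<close> applies. If one is small but nonzero, the
  second weight on the chart is combined with the previous theorem on the hyperplane.\<close>

theorem card_supp_hform_space_ge:
  fixes W :: "((nat \<Rightarrow> 'a::{field,finite}) \<Rightarrow> 'a) set"
  assumes "hform_space (Suc n) W" "CARD('a) ^ n < card W"
  shows "2 * (real CARD('a) - 1) * real CARD('a) ^ n \<le> real CARD('a) * card (supp (Suc n) W)"
  using assms
proof (induction n arbitrary: W)
  case 0
  interpret hform_space "Suc 0" W by fact
  have q: "2 \<le> real CARD('a)"
    using card_field_ge_2[where 'a = 'a] by linarith
  have "W \<noteq> {0}"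
    using "0.prems"(2) by auto
  then obtain f where f: "f \<in> W" "f \<noteq> 0"
    using additive_subgroup_ne_zero[OF subgroup] by blast
  have "real CARD('a) - 1 \<le> card (supp (Suc 0) W)"
    using card_supp_cone_ge[OF hform[OF f(1)] _ f] by (simp add: of_nat_diff)
  \<comment> \<open>Since 2 is at most q, the multiples of one vector are enough.\<close>
  then show ?case
    using mult_mono[of 2 "real CARD('a)" "real CARD('a) - 1" "card (supp (Suc 0) W)"] q by simp
next
  case (Suc n)
  interpret hform_space "Suc (Suc n)" W by fact
  let ?q = "real CARD('a)"
  let ?R = "\<lambda>b. section_at (Suc n) b 0 ` W"
  have q: "2 \<le> ?q"
    using card_field_ge_2[where 'a = 'a] by linarith
  show ?case
  proof (cases "\<forall>b\<in>pts (Suc n). CARD('a) ^ n < card (?R b)")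
    case True
    have "?q * (2 * (?q - 1) * ?q ^ n / ?q) \<le> card (supp (Suc (Suc n)) W)"
    proof (rule card_supp_ge_if_sections_ge)
      show "f (\<lambda>_. 0) = 0" if "f \<in> W" for f
        using hform_zero_at_0[OF hform[OF that]] by simp
      show "2 * (?q - 1) * ?q ^ n / ?q \<le> card (supp (Suc n) (?R b))"
        if "b \<in> pts (Suc n)" for b
        using Suc.IH[OF hform_space_section_at_0[OF Suc.prems(1)] True[rule_format, OF that]] q
        by (simp add: divide_le_eq mult.commute)
    qed
    then have "?q * (2 * (?q - 1) * ?q ^ n) \<le> ?q * card (supp (Suc (Suc n)) W)"
      using q by simp
    then show ?thesis by (simp add: mult_ac)
  next
    case False
    then obtain b where b: "card (?R b) \<le> CARD('a) ^ n"
      by (auto simp: not_less)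
    define G where "G = section_at (Suc n) b 1 ` {f \<in> W. section_at (Suc n) b 0 f = 0}"
    note kernel = hyperplane_kernel[OF Suc.prems(1), of b, folded G_def]
    have "G \<subseteq> section_at (Suc n) b 1 ` W"
      by (auto simp: G_def)
    note supp = card_supp_ge_section_at_1[OF Suc.prems(1) this]
    show ?thesis
    proof (cases "?R b = {0}")
      case True
      then have "CARD('a) ^ Suc n < card G"
        using kernel(2) Suc.prems(2) by simp
      then have "2 * ?q ^ Suc n \<le> ?q * card (supp (Suc n) G)"
        using card_supp_ge_third[OF kernel(1)] by (simp add: of_nat_diff)
      then have "(?q - 1) * (2 * ?q ^ Suc n) \<le> (?q - 1) * (?q * card (supp (Suc n) G))"
        using q by (intro mult_left_mono) auto
      also have "\<dots> = ?q * ((?q - 1) * card (supp (Suc n) G))"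
        by simp
      also have "\<dots> \<le> ?q * card (supp (Suc (Suc n)) W)"
        using supp by (intro mult_left_mono) linarith+
      finally show ?thesis by (simp only: mult_ac)
    next
      case False
      have "CARD('a) < card G"
      proof (rule ccontr)
        assume "\<not> CARD('a) < card G"
        then have "card W \<le> CARD('a) ^ n * CARD('a)"
          unfolding kernel(2) using b by (intro mult_le_mono) auto
        then show False
          using Suc.prems(2) by (simp add: mult.commute)
      qed
      from card_supp_ge_second[OF kernel(1) this]
      have "2 * ?q ^ (Suc n + 1) - ?q ^ Suc n \<le> ?q ^ 2 * card (supp (Suc n) G)"
        by (simp add: of_nat_diff)
      then have G: "(?q - 1) * (2 * ?q ^ (Suc n + 1) - ?q ^ Suc n)
          \<le> (?q - 1) * (?q ^ 2 * card (supp (Suc n) G))"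
        using q by (intro mult_left_mono) auto
      have "(?q - 1) * ?q ^ n \<le> ?q * card (supp (Suc n) (?R b))"
        using card_supp_hform_space_ge_first[OF hform_space_section_at_0[OF Suc.prems(1)] False] .
      then have "?q * ((?q - 1) * ?q ^ n) \<le> ?q * (?q * card (supp (Suc n) (?R b)))"
        by (intro mult_left_mono) auto
      \<comment> \<open>The deficit \<open>?q ^ Suc n\<close> of the second weight, times q - 1, is
        exactly what the nonzero restriction contributes.\<close>
      with G have "?q * (2 * (?q - 1) * ?q ^ Suc n)
          \<le> ?q * (?q * (card (supp (Suc n) (?R b)) + (?q - 1) * card (supp (Suc n) G)))"
        by (simp add: algebra_simps power2_eq_square)
      also have "\<dots> \<le> ?q * (?q * card (supp (Suc (Suc n)) W))"
        using supp by (intro mult_left_mono) auto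
      finally show ?thesis
        using q by simp
    qed
  qed
qed

section \<open>Evaluation of forms\<close>

definition mon_eval :: "(nat \<Rightarrow> 'a) \<Rightarrow> (nat \<Rightarrow>\<^sub>0 nat) \<Rightarrow> 'a::comm_semiring_1" where
  "mon_eval x u = (\<Prod>i\<in>Poly_Mapping.keys u. x i ^ Poly_Mapping.lookup u i)"

text \<open>A common finite index set allows several monomials to be treated at once; the next two
  lemmas serve the same purpose.\<close>

lemma mon_eval_superset:
  assumes "finite K" "Poly_Mapping.keys u \<subseteq> K"
  shows "mon_eval x u = (\<Prod>i\<in>K. x i ^ Poly_Mapping.lookup u i)"
  unfolding mon_eval_def
  by (rule prod.mono_neutral_left) (use assms in \<open>auto simp: in_keys_iff\<close>)

lemma mon_degree_superset:
  assumes "finite K" "Poly_Mapping.keys u \<subseteq> K"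
  shows "mon_degree u = (\<Sum>i\<in>K. Poly_Mapping.lookup u i)"
  unfolding mon_degree_def
  by (rule sum.mono_neutral_left) (use assms in \<open>auto simp: in_keys_iff\<close>)

lemma mpoly_eval_superset:
  assumes "finite K" "Poly_Mapping.keys F \<subseteq> K"
  shows "mpoly_eval x F = (\<Sum>u\<in>K. Poly_Mapping.lookup F u * mon_eval x u)"
  unfolding mpoly_eval_def mon_eval_def
  by (rule sum.mono_neutral_left) (use assms in \<open>auto simp: in_keys_iff\<close>)

lemma mpoly_eval_0 [simp]: "mpoly_eval x 0 = 0"
  by (simp add: mpoly_eval_def)

lemma mpoly_eval_add: "mpoly_eval x (F + G) = mpoly_eval x F + mpoly_eval x G"
proof -
  let ?K = "Poly_Mapping.keys F \<union> Poly_Mapping.keys G"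
  have "mpoly_eval x H = (\<Sum>u\<in>?K. Poly_Mapping.lookup H u * mon_eval x u)"
    if "Poly_Mapping.keys H \<subseteq> ?K" for H
    using that by (intro mpoly_eval_superset) auto
  from this[of F] this[of G] this[OF Poly_Mapping.keys_add] show ?thesis
    by (simp add: lookup_add distrib_right sum.distrib)
qed

lemma keys_mpoly_scale: "Poly_Mapping.keys (mpoly_scale c F) \<subseteq> Poly_Mapping.keys F"
  by (auto simp: in_keys_iff lookup_mpoly_scale)

lemma mpoly_eval_scale: "mpoly_eval x (mpoly_scale c F) = c * mpoly_eval x F"
  by (simp add: mpoly_eval_superset[OF finite_keys keys_mpoly_scale]
      mpoly_eval_superset[OF finite_keys[of F] order.refl]
      lookup_mpoly_scale sum_distrib_left mult.assoc)

lemma mpoly_eval_sum: "mpoly_eval x (\<Sum>i\<in>A. F i) = (\<Sum>i\<in>A. mpoly_eval x (F i))"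
  by (induction A rule: infinite_finite_induct) (simp_all add: mpoly_eval_add)

lemma forms_0: "0 \<in> forms m d"
  by (simp add: forms_def)

lemma forms_add: "F \<in> forms m d \<Longrightarrow> G \<in> forms m d \<Longrightarrow> F + G \<in> forms m d"
  using Poly_Mapping.keys_add[of F G] unfolding forms_def by blast

lemma forms_scale: "F \<in> forms m d \<Longrightarrow> mpoly_scale c F \<in> forms m d"
  using keys_mpoly_scale[of c F] unfolding forms_def by blast

lemma forms_sum: "(\<And>i. i \<in> A \<Longrightarrow> F i \<in> forms m d) \<Longrightarrow> (\<Sum>i\<in>A. F i) \<in> forms m d"
  by (induction A rule: infinite_finite_induct) (simp_all add: forms_0 forms_add)

lemma hform_power_mult:
  assumes "i < n" "hform n d f"
  shows "hform n (k + d) (\<lambda>x. x i ^ k * f x)"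
proof (induction k)
  case (Suc k)
  then show ?case
    using hform.var[OF assms(1) Suc.IH] by (simp add: mult.assoc)
qed (use assms in simp)

lemma hform_prod_powers:
  assumes "finite K" "K \<subseteq> {..<n}"
  shows "hform n (\<Sum>i\<in>K. e i) (\<lambda>x. \<Prod>i\<in>K. x i ^ e i :: 'a::comm_ring_1)"
  using assms
proof (induction K rule: finite_induct)
  case empty
  then show ?case by (simp add: hform.const)
next
  case (insert i K)
  then show ?case
    using hform_power_mult[of i n "\<Sum>i\<in>K. e i" "\<lambda>x. \<Prod>i\<in>K. x i ^ e i" "e i"] by simp
qed

lemma hform_mpoly_eval:
  fixes F :: "'a::comm_ring_1 mpoly"
  assumes "F \<in> forms m d"
  shows "hform (Suc m) d (\<lambda>x. mpoly_eval x F)"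
  unfolding mpoly_eval_def
proof (intro hform_sum hform_cmul)
  fix u assume "u \<in> Poly_Mapping.keys F"
  then have "Poly_Mapping.keys u \<subseteq> {..<Suc m}" "mon_degree u = d"
    using assms by (auto simp: forms_def lessThan_Suc_atMost)
  then show "hform (Suc m) d (\<lambda>x :: nat \<Rightarrow> 'a. \<Prod>i\<in>Poly_Mapping.keys u. x i ^ Poly_Mapping.lookup u i)"
    using hform_prod_powers[of "Poly_Mapping.keys u" "Suc m" "Poly_Mapping.lookup u"]
    by (simp add: mon_degree_def)
qed

section \<open>Forms of degree \<open>q\<close> as functions\<close>

text \<open>Multiplication by a nonzero \<open>x\<close> permutes the nonzero elements and so
  preserves their product.\<close>

lemma power_card_field: "x ^ CARD('a) = (x :: 'a::{field,finite})"
proof (cases "x = 0")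
  case False
  have "x ^ (CARD('a) - 1) * \<Prod>(UNIV - {0}) = (\<Prod>y\<in>UNIV - {0}. x * y)"
    by (simp add: prod.distrib card_Diff_singleton)
  also have "\<dots> = \<Prod>(UNIV - {0})"
    by (rule prod.reindex_bij_witness[of _ "\<lambda>y. y / x" "\<lambda>y. x * y"]) (use False in auto)
  finally have "x ^ (CARD('a) - 1) = 1"
    by simp
  then have "x * x ^ (CARD('a) - 1) = x"
    by simp
  then show ?thesis
    by (simp flip: power_Suc)
qed (simp add: zero_power)

lemma power_card_minus_1_field: "(x :: 'a::{field,finite}) ^ (CARD('a) - 1) = (if x = 0 then 0 else 1)"
proof -
  have "x * x ^ (CARD('a) - 1) = x"
    using power_card_field[of x] by (simp flip: power_Suc)
  moreover have "0 < CARD('a) - 1"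
    using card_field_ge_2[where 'a = 'a] by simp
  ultimately show ?thesis by (auto simp: zero_power)
qed

text \<open>For fixed first \<open>n\<close> coordinates the sum is a polynomial of degree below q
  in the last one with q roots. Its coefficients vanish, and each is a sum of the same kind in one
  variable less.\<close>

lemma reduced_monomials_independent:
  fixes c :: "(nat \<Rightarrow> nat) \<Rightarrow> 'a::{field,finite}"
  assumes "finite E" "\<And>e i. e \<in> E \<Longrightarrow> e i < CARD('a)" "\<And>e i. e \<in> E \<Longrightarrow> i \<ge> n \<Longrightarrow> e i = 0"
    and "\<And>x. x \<in> pts n \<Longrightarrow> (\<Sum>e\<in>E. c e * (\<Prod>i<n. x i ^ e i)) = 0" and "e \<in> E"
  shows "c e = 0"
  using assms
proof (induction n arbitrary: E c e)
  case 0
  have "e' = (\<lambda>_. 0)" if "e' \<in> E" for e'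
    using 0(3)[OF that] by auto
  then have "E = {e}"
    using \<open>e \<in> E\<close> by auto
  then show ?case
    using 0(4)[of "\<lambda>_. 0"] by (simp add: pts_0)
next
  case (Suc n)
  \<comment> \<open>Only monomials with the same last exponent as \<open>e\<close> enter;
    \<open>r\<close> erases this exponent and \<open>C\<close> restores it.\<close>
  define t where "t = e n"
  define r where "r e' = e'(n := 0 :: nat)" for e'
  define E' where "E' = {e' \<in> E. e' n = t}"
  define C where "C e' = c (e'(n := t))" for e'
  have r: "(r e')(n := t) = e'" if "e' \<in> E'" for e'
    using that by (auto simp: r_def E'_def)
  have inj: "inj_on r E'"
    using r by (metis inj_onI)
  have "(\<Sum>e'\<in>r ` E'. C e' * (\<Prod>i<n. x i ^ e' i)) = 0" if x: "x \<in> pts n" for x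
  proof -
    define p where "p = (\<Sum>e\<in>E. monom (c e * (\<Prod>i<n. x i ^ e i)) (e n))"
    have "poly p s = 0" for s
    proof -
      have "x(n := s) \<in> pts (Suc n)"
        using x by (auto simp: pts_def)
      from Suc.prems(4)[OF this] show ?thesis
        by (simp add: p_def poly_sum poly_monom mult.assoc)
    qed
    moreover have "degree p < CARD('a)"
    proof -
      have "degree p \<le> CARD('a) - 1"
        unfolding p_def
      proof (rule degree_sum_le[OF Suc.prems(1)])
        fix e assume "e \<in> E"
        then have "e n \<le> CARD('a) - 1"
          using Suc.prems(2)[of e n] by linarith
        then show "degree (monom (c e * (\<Prod>i<n. x i ^ e i)) (e n)) \<le> CARD('a) - 1"
          by (rule order.trans[OF degree_monom_le])
      qed
      then show ?thesis
        using card_field_ge_2[where 'a = 'a] by linarith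
    qed
    ultimately have "p = 0"
      by (intro poly_eqI_degree[of UNIV]) auto
    then have "poly.coeff p t = 0"
      by simp
    then have "(\<Sum>e\<in>E'. c e * (\<Prod>i<n. x i ^ e i)) = 0"
      using Suc.prems(1) by (simp add: p_def coeff_sum E'_def sum.inter_filter if_distrib cong: if_cong)
    moreover have "C (r e) * (\<Prod>i<n. x i ^ r e i) = c e * (\<Prod>i<n. x i ^ e i)" if "e \<in> E'" for e
      using r[OF that] by (simp add: C_def) (simp add: r_def)
    ultimately show ?thesis
      by (simp add: sum.reindex[OF inj])
  qed
  then have "C (r e) = 0"
  proof (rule Suc.IH[rotated 3])
    show "r e \<in> r ` E'"
      using Suc.prems(5) by (simp add: E'_def t_def)
  qed (use Suc.prems(1,2,3) in \<open>auto simp: E'_def r_def not_less_eq_eq le_Suc_eq\<close>)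
  then show ?case
    using r[of e] Suc.prems(5) by (simp add: C_def E'_def t_def)
qed

text \<open>
  The monomials of degree \<open>q\<close> remain distinct when reduced with \<open>x\<^sup>q = x\<close>: only the pure powers
  \<open>X\<^sub>i\<^sup>q\<close> change, and they become the \<open>X\<^sub>i\<close>, of degree \<open>1 \<noteq> q\<close>.
\<close>

lemma form_eq_0_if_vanishes:
  fixes F :: "'a::{field,finite} mpoly"
  assumes F: "F \<in> forms m CARD('a)" and vanish: "\<And>x. x \<in> pts (Suc m) \<Longrightarrow> mpoly_eval x F = 0"
  shows "F = 0"
proof -
  let ?q = "CARD('a)"
  define red where "red k = (if k = ?q then 1 else k)" for k
  define r where "r u i = red (Poly_Mapping.lookup u i)" for u :: "nat \<Rightarrow>\<^sub>0 nat" and i :: nat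
  have q: "2 \<le> ?q"
    by (rule card_field_ge_2)
  have keys: "Poly_Mapping.keys u \<subseteq> {..<Suc m}" "(\<Sum>i<Suc m. Poly_Mapping.lookup u i) = ?q"
    if "u \<in> Poly_Mapping.keys F" for u
  proof -
    show sub: "Poly_Mapping.keys u \<subseteq> {..<Suc m}"
      using that F by (auto simp: forms_def lessThan_Suc_atMost)
    show "(\<Sum>i<Suc m. Poly_Mapping.lookup u i) = ?q"
      using that F mon_degree_superset[OF _ sub] by (simp add: forms_def)
  qed
  have outside: "Poly_Mapping.lookup u i = 0" if "u \<in> Poly_Mapping.keys F" "\<not> i < Suc m" for u i
    using keys(1)[OF that(1)] that(2) by (auto simp: in_keys_iff)
  have le: "Poly_Mapping.lookup u i \<le> ?q" if u: "u \<in> Poly_Mapping.keys F" for u i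
  proof (cases "i < Suc m")
    case True
    then have "Poly_Mapping.lookup u i \<le> (\<Sum>i<Suc m. Poly_Mapping.lookup u i)"
      by (intro member_le_sum) auto
    then show ?thesis using keys(2)[OF u] by simp
  qed (simp add: outside[OF u])
  \<comment> \<open>An exponent q exhausts the total degree.\<close>
  have pure: "Poly_Mapping.lookup u j = 0"
    if u: "u \<in> Poly_Mapping.keys F" "Poly_Mapping.lookup u i = ?q" "j \<noteq> i" for u i j
  proof (cases "j < Suc m")
    case True
    have "i < Suc m"
      using outside[OF u(1), of i] u(2) q by auto
    with True have "Poly_Mapping.lookup u i + Poly_Mapping.lookup u j = (\<Sum>k\<in>{i, j}. Poly_Mapping.lookup u k)"
      using u(3) by simp
    also have "\<dots> \<le> (\<Sum>k<Suc m. Poly_Mapping.lookup u k)"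
      using True \<open>i < Suc m\<close> by (intro sum_mono2) auto
    finally show ?thesis
      using keys(2)[OF u(1)] u(2) by simp
  qed (simp add: outside[OF u(1)])
  have sum_r: "(\<Sum>i<Suc m. r u i) = (if \<exists>i. Poly_Mapping.lookup u i = ?q then 1 else ?q)"
    if u: "u \<in> Poly_Mapping.keys F" for u
  proof (cases "\<exists>i. Poly_Mapping.lookup u i = ?q")
    case True
    then obtain i where i: "Poly_Mapping.lookup u i = ?q" by blast
    then have "i < Suc m"
      using outside[OF u, of i] q by auto
    moreover have "r u j = (if j = i then 1 else 0)" for j
      using pure[OF u i, of j] i q by (auto simp: r_def red_def)
    ultimately show ?thesis
      using True by simp
  next
    case False
    then have "r u = Poly_Mapping.lookup u"
      by (auto simp: r_def red_def fun_eq_iff)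
    then show ?thesis
      using False keys(2)[OF u] by simp
  qed
  have inj: "inj_on r (Poly_Mapping.keys F)"
  proof (rule inj_onI)
    fix u v assume u: "u \<in> Poly_Mapping.keys F" and v: "v \<in> Poly_Mapping.keys F" and eq: "r u = r v"
    let ?A = "\<lambda>w. \<exists>i. Poly_Mapping.lookup w i = ?q"
    have "A \<longleftrightarrow> B" if "(if A then 1 else ?q) = (if B then 1 else ?q)" for A B
      using that q by (auto split: if_splits)
    then have iff: "?A u \<longleftrightarrow> ?A v"
      by this (simp only: sum_r[OF u, symmetric] sum_r[OF v, symmetric] eq)
    have "Poly_Mapping.lookup u k = Poly_Mapping.lookup v k" for k
    proof (cases "\<exists>i. Poly_Mapping.lookup u i = ?q")
      case True
      then obtain i j where ij: "Poly_Mapping.lookup u i = ?q" "Poly_Mapping.lookup v j = ?q"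
        using iff by blast
      have "r v i = 1"
        using ij(1) eq by (metis r_def red_def)
      then have "Poly_Mapping.lookup v i \<noteq> 0"
        using q by (auto simp: r_def red_def split: if_splits)
      then have "j = i"
        using pure[OF v ij(2), of i] by (cases "i = j") simp_all
      then show ?thesis
        using pure[OF u ij(1), of k] pure[OF v ij(2), of k] ij by (cases "k = i") auto
    next
      case False
      then have "r u k = Poly_Mapping.lookup u k" "r v k = Poly_Mapping.lookup v k"
        using iff by (auto simp: r_def red_def)
      then show ?thesis using eq by simp
    qed
    then show "u = v" by (rule poly_mapping_eqI)
  qed
  have "Poly_Mapping.lookup F u = 0" if u: "u \<in> Poly_Mapping.keys F" for u
  proof -
    \<comment> \<open>The coefficients are carried to the reduced exponents through the inverse of
      \<open>r\<close>, which is injective on the monomials of \<open>F\<close>.\<close>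
    let ?c = "\<lambda>e. Poly_Mapping.lookup F (the_inv_into (Poly_Mapping.keys F) r e)"
    have "?c (r u) = 0"
    proof (rule reduced_monomials_independent[where c = ?c and e = "r u" and E = "r ` Poly_Mapping.keys F" and n = "Suc m"])
      fix x :: "nat \<Rightarrow> 'a" assume x: "x \<in> pts (Suc m)"
      have "y ^ red k = y ^ k" for y :: 'a and k
        by (simp add: red_def power_card_field)
      then have "(\<Sum>e\<in>r ` Poly_Mapping.keys F. ?c e * (\<Prod>i<Suc m. x i ^ e i))
          = (\<Sum>u\<in>Poly_Mapping.keys F. Poly_Mapping.lookup F u * (\<Prod>i<Suc m. x i ^ Poly_Mapping.lookup u i))"
        by (simp add: sum.reindex[OF inj] the_inv_into_f_f[OF inj] r_def del: prod.lessThan_Suc)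
      also have "\<dots> = mpoly_eval x F"
        unfolding mpoly_eval_superset[OF finite_keys order.refl]
        by (intro sum.cong refl) (simp only: mon_eval_superset[OF finite_lessThan keys(1)])
      finally show "(\<Sum>e\<in>r ` Poly_Mapping.keys F. ?c e * (\<Prod>i<Suc m. x i ^ e i)) = 0"
        using vanish[OF x] by simp
    next
      fix e i assume e: "e \<in> r ` Poly_Mapping.keys F"
      then show "e i < ?q"
        using le q by (fastforce simp: r_def red_def le_less)
      show "e i = 0" if "Suc m \<le> i"
        using e outside that q by (auto simp: r_def red_def)
    qed (use u in auto)
    then show ?thesis
      by (simp add: the_inv_into_f_f[OF inj u])
  qed
  then show ?thesis
    by (metis in_keys_iff keys_eq_empty subset_antisym subset_empty subsetI ex_in_conv)
qed

section \<open>The space of functions spanned by independent forms\<close>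

definition span_fun :: "'a::{field,finite} mpoly set \<Rightarrow> ('a mpoly \<Rightarrow> 'a) \<Rightarrow> (nat \<Rightarrow> 'a) \<Rightarrow> 'a" where
  "span_fun \<F> c = (\<lambda>x. \<Sum>F\<in>\<F>. c F * mpoly_eval x F)"

lemma hform_space_span_fun:
  fixes \<F> :: "'a::{field,finite} mpoly set"
  assumes "\<F> \<subseteq> forms m CARD('a)"
  shows "hform_space (Suc m) (range (span_fun \<F>))"
proof
  fix f assume "f \<in> range (span_fun \<F>)"
  then show "hform (Suc m) CARD('a) f"
    using assms by (auto simp: span_fun_def intro!: hform_sum hform_cmul hform_mpoly_eval)
next
  have zero: "span_fun \<F> (\<lambda>_. 0) = 0"
    by (auto simp: span_fun_def)
  have diff: "span_fun \<F> c - span_fun \<F> c' = span_fun \<F> (\<lambda>F. c F - c' F)" for c c'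
    by (auto simp: span_fun_def algebra_simps sum_subtractf)
  show "additive_subgroup (range (span_fun \<F>))"
    unfolding additive_subgroup_def
  proof (intro conjI ballI)
    show "0 \<in> range (span_fun \<F>)"
      using zero by (metis rangeI)
    fix f g assume "f \<in> range (span_fun \<F>)" "g \<in> range (span_fun \<F>)"
    then obtain c c' where "f = span_fun \<F> c" "g = span_fun \<F> c'" by auto
    then show "f - g \<in> range (span_fun \<F>)"
      using diff by simp
  qed
qed

text \<open>Combinations that agree as functions differ by a form vanishing everywhere, hence by the
  zero polynomial; independence then makes the coefficients equal. Coefficient vectors are
  extensional, so their values on \<open>\<F>\<close> determine them.\<close>

lemma card_range_span_fun:
  fixes \<F> :: "'a::{field,finite} mpoly set"
  assumes "\<F> \<subseteq> forms m CARD('a)" "finite \<F>" "mpoly.independent \<F>"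
  shows "CARD('a) ^ card \<F> \<le> card (range (span_fun \<F>))"
proof -
  have "inj_on (span_fun \<F>) (\<F> \<rightarrow>\<^sub>E UNIV)"
  proof (rule inj_onI)
    fix c c' :: "'a mpoly \<Rightarrow> 'a"
    assume c: "c \<in> \<F> \<rightarrow>\<^sub>E UNIV" "c' \<in> \<F> \<rightarrow>\<^sub>E UNIV" and eq: "span_fun \<F> c = span_fun \<F> c'"
    let ?G = "\<Sum>F\<in>\<F>. mpoly_scale (c F - c' F) F"
    have "?G = 0"
    proof (rule form_eq_0_if_vanishes)
      show "?G \<in> forms m CARD('a)"
        using assms(1) by (intro forms_sum forms_scale) auto
      show "mpoly_eval x ?G = 0" for x
        using fun_cong[OF eq, of x]
        by (simp add: span_fun_def mpoly_eval_sum mpoly_eval_scale left_diff_distrib sum_subtractf)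
    qed
    have "\<forall>F\<in>\<F>. c F - c' F = 0"
    proof (rule ccontr)
      assume "\<not> (\<forall>F\<in>\<F>. c F - c' F = 0)"
      with \<open>?G = 0\<close> have "\<exists>u. (\<exists>F\<in>\<F>. u F \<noteq> 0) \<and> (\<Sum>F\<in>\<F>. mpoly_scale (u F) F) = 0"
        by (intro exI[of _ "\<lambda>F. c F - c' F"]) simp
      then show False
        using assms(3) unfolding mpoly.dependent_finite[OF assms(2)] by simp
    qed
    then show "c = c'"
      by (intro PiE_ext[OF c]) auto
  qed
  then have "card (\<F> \<rightarrow>\<^sub>E (UNIV :: 'a set)) = card (span_fun \<F> ` (\<F> \<rightarrow>\<^sub>E UNIV))"
    by (simp add: card_image)
  also have "\<dots> \<le> card (range (span_fun \<F>))"
    using hform_space.finite[OF hform_space_span_fun[OF assms(1)]] by (intro card_mono) auto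
  finally show ?thesis
    by (simp add: card_funcsetE[OF assms(2)])
qed

section \<open>Points of projective space\<close>

lemma nonzero_vecs_eq: "nonzero_vecs m = pts (Suc m) - {\<lambda>_. 0}"
proof (intro equalityI subsetI)
  fix x :: "nat \<Rightarrow> 'a" assume x: "x \<in> pts (Suc m) - {\<lambda>_. 0}"
  then obtain i where i: "x i \<noteq> 0" by auto
  then have "\<not> Suc m \<le> i"
    using x unfolding pts_def by blast
  with i x show "x \<in> nonzero_vecs m"
    by (auto simp: nonzero_vecs_def pts_def not_less_eq_eq)
qed (auto simp: nonzero_vecs_def pts_def)

text \<open>A projective point is a class of q - 1 vectors, and by homogeneity a form vanishes on
  all of them or on none.\<close>

lemma card_proj_zeros:
  fixes \<F> :: "'a::{field,finite} mpoly set"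
  assumes "\<F> \<subseteq> forms m d"
  shows "(CARD('a) - 1) * card (proj_zeros m \<F>)
    = card {x \<in> nonzero_vecs m. \<forall>F\<in>\<F>. mpoly_eval x F = 0}"
proof -
  let ?Z = "{x \<in> nonzero_vecs m. \<forall>F\<in>\<F>. mpoly_eval x F = 0}"
  note equiv = equiv_proj_rel[where 'a = 'a, of m]
  have class_card: "card P = CARD('a) - 1" if P: "P \<in> proj_zeros m \<F>" for P
  proof -
    obtain x where x: "x \<in> nonzero_vecs m" "P = proj_rel m `` {x}"
      using P by (auto simp: proj_zeros_def proj_space_def elim!: quotientE)
    then obtain j where j: "x j \<noteq> 0"
      by (auto simp: nonzero_vecs_def)
    have "P = (\<lambda>c i. c * x i) ` (UNIV - {0})"
      using x by (auto simp: proj_rel_def nonzero_vecs_def)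
    moreover have "inj_on (\<lambda>c i. c * x i) (UNIV - {0})"
      using j by (intro inj_onI) (metis mult_cancel_right)
    ultimately show ?thesis
      by (simp add: card_image card_Diff_singleton)
  qed
  have Union: "\<Union> (proj_zeros m \<F>) = ?Z"
  proof (intro equalityI subsetI)
    fix x assume "x \<in> \<Union> (proj_zeros m \<F>)"
    then show "x \<in> ?Z"
      using Union_quotient[OF equiv] by (auto simp: proj_zeros_def proj_space_def)
  next
    fix x assume x: "x \<in> ?Z"
    have "mpoly_eval y F = 0" if "F \<in> \<F>" "y \<in> proj_rel m `` {x}" for F y
      using that x assms hform_scale[OF hform_mpoly_eval, of F m d _ x] by (auto simp: proj_rel_def)
    then have "proj_rel m `` {x} \<in> proj_zeros m \<F>"
      using x by (auto simp: proj_zeros_def proj_space_def intro: quotientI)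
    moreover have "x \<in> proj_rel m `` {x}"
      using x equiv_class_self[OF equiv] by blast
    ultimately show "x \<in> \<Union> (proj_zeros m \<F>)" by blast
  qed
  have fin: "finite (proj_zeros m \<F>)"
    using finite_proj_space[where 'a = 'a, of m] by (rule rev_finite_subset) (auto simp: proj_zeros_def)
  have "(CARD('a) - 1) * card (proj_zeros m \<F>) = card (\<Union> (proj_zeros m \<F>))"
  proof (rule card_partition[OF fin])
    show "finite (\<Union> (proj_zeros m \<F>))"
      unfolding Union nonzero_vecs_eq by (simp add: finite_pts)
    show "P \<inter> P' = {}" if "P \<in> proj_zeros m \<F>" "P' \<in> proj_zeros m \<F>" "P \<noteq> P'" for P P'
      using that quotient_disj[OF equiv] by (auto simp: proj_zeros_def proj_space_def)
  qed (rule class_card)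
  then show ?thesis by (simp only: Union)
qed

text \<open>A geometric sum. For \<open>m = 1\<close> the index is negative and the identity reads 1
  = 1.\<close>

lemma proj_count_eq:
  assumes "q > 0" "m > 0"
  shows "(q - 1) * proj_count q (int m - 2) + 1 = q ^ (m - 1)"
proof -
  have geometric: "(q - 1) * (\<Sum>i\<le>k. q ^ i) + 1 = q ^ Suc k" for k
  proof (induction k)
    case (Suc k)
    have "(q - 1) * q ^ Suc k + q ^ Suc k = q * q ^ Suc k"
      using assms(1) by (cases q) auto
    then show ?case
      using Suc.IH by (simp only: sum.atMost_Suc distrib_left power_Suc)
  qed (use assms in simp)
  consider "m = 1" | k where "m = Suc (Suc k)"
    using assms(2) by (metis One_nat_def gr0_implies_Suc not0_implies_Suc)
  then show ?thesis
    using geometric by cases (auto simp: proj_count_def)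
qed

section \<open>The extremal family\<close>

lemma card_pts_box:
  fixes A :: "nat \<Rightarrow> 'a::{zero,finite} set"
  shows "card {x \<in> pts n. \<forall>i<n. x i \<in> A i} = (\<Prod>i<n. card (A i))"
proof (induction n)
  case (Suc n)
  have "card {x \<in> pts (Suc n). \<forall>i<Suc n. x i \<in> A i}
      = (\<Sum>x\<in>pts n. if \<forall>i<n. x i \<in> A i then card (A n) else 0)"
    unfolding card_pts_Suc_filter
    by (intro sum.cong) (auto simp: less_Suc_eq intro!: arg_cong[where f = card])
  then show ?case
    using Suc.IH finite_pts[where 'a = 'a, of n] by (simp add: sum.If_cases Int_def)
qed (simp add: pts_0)

lemma card_pts_first_two:
  fixes A B :: "'a::{zero,finite} set"
  shows "card {x \<in> pts (Suc (Suc n)). x 0 \<in> A \<and> x 1 \<in> B} = card A * card B * CARD('a) ^ n"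
proof -
  let ?C = "\<lambda>i. if i = 0 then A else if i = 1 then B else UNIV"
  have "{x \<in> pts (Suc (Suc n)). x 0 \<in> A \<and> x 1 \<in> B}
      = {x \<in> pts (Suc (Suc n)). \<forall>i<Suc (Suc n). x i \<in> ?C i}"
    by auto
  then have "card {x \<in> pts (Suc (Suc n)). x 0 \<in> A \<and> x 1 \<in> B} = (\<Prod>i<Suc (Suc n). card (?C i))"
    by (simp only: card_pts_box)
  also have "\<dots> = card A * card B * CARD('a) ^ n"
    by (simp add: prod.lessThan_Suc_shift del: prod.lessThan_Suc)
  finally show ?thesis .
qed

lemma mon_eval_add: "mon_eval x (u + v) = mon_eval x u * mon_eval x v"
proof -
  let ?K = "Poly_Mapping.keys u \<union> Poly_Mapping.keys v"
  have "mon_eval x w = (\<Prod>i\<in>?K. x i ^ Poly_Mapping.lookup w i)"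
    if "Poly_Mapping.keys w \<subseteq> ?K" for w
    using that by (intro mon_eval_superset) auto
  from this[of u] this[of v] this[OF Poly_Mapping.keys_add] show ?thesis
    by (simp add: lookup_add power_add prod.distrib)
qed

lemma mon_degree_add: "mon_degree (u + v) = mon_degree u + mon_degree v"
proof -
  let ?K = "Poly_Mapping.keys u \<union> Poly_Mapping.keys v"
  have "mon_degree w = (\<Sum>i\<in>?K. Poly_Mapping.lookup w i)"
    if "Poly_Mapping.keys w \<subseteq> ?K" for w
    using that by (intro mon_degree_superset) auto
  from this[of u] this[of v] this[OF Poly_Mapping.keys_add] show ?thesis
    by (simp add: lookup_add sum.distrib)
qed

lemma mon_eval_single: "mon_eval x (Poly_Mapping.single i k) = x i ^ k"
  by (subst mon_eval_superset[of "{i}"]) auto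

lemma mon_degree_single: "mon_degree (Poly_Mapping.single i k) = k"
  by (subst mon_degree_superset[of "{i}"]) auto

lemma mpoly_eval_single: "mpoly_eval x (Poly_Mapping.single u c) = c * mon_eval x u"
  by (subst mpoly_eval_superset[of "{u}"]) auto

definition pencil_mon :: "nat \<Rightarrow> nat \<Rightarrow> nat \<Rightarrow> nat \<Rightarrow>\<^sub>0 nat" where
  "pencil_mon q j i = Poly_Mapping.single i 1 + Poly_Mapping.single j (q - 1)"

text \<open>The factor X_0^(q-1) - X_1^(q-1) is the product of X_0 - c X_1 over all nonzero c, so
  its zeros fill q - 1 hyperplanes of the pencil through X_0 = X_1 = 0. The factor X_i raises the
  degree to q; as a nonzero vector has some nonzero coordinate, it adds no zeros common to all
  i.\<close>

definition pencil_form :: "nat \<Rightarrow> 'a::{field,finite} mpoly" where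
  "pencil_form i = Poly_Mapping.single (pencil_mon CARD('a) 0 i) 1
                 + Poly_Mapping.single (pencil_mon CARD('a) 1 i) (- 1)"

lemma pencil_form_in_forms:
  assumes "i \<le> m" "m > 0"
  shows "(pencil_form i :: 'a::{field,finite} mpoly) \<in> forms m CARD('a)"
proof -
  have "(Poly_Mapping.single (pencil_mon CARD('a) j i) c :: 'a mpoly) \<in> forms m CARD('a)"
    if "j \<le> m" for j and c :: 'a
  proof -
    have "Poly_Mapping.keys (pencil_mon CARD('a) j i) \<subseteq> {..m}"
      using Poly_Mapping.keys_add[of "Poly_Mapping.single i 1" "Poly_Mapping.single j (CARD('a) - 1)"]
        assms that by (auto simp: pencil_mon_def split: if_splits)
    then show ?thesis
      by (auto simp: forms_def pencil_mon_def mon_degree_add mon_degree_single)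
  qed
  then show ?thesis
    unfolding pencil_form_def using assms by (intro forms_add) auto
qed

lemma mpoly_eval_pencil_form:
  fixes x :: "nat \<Rightarrow> 'a::{field,finite}"
  shows "mpoly_eval x (pencil_form i) = x i * (x 0 ^ (CARD('a) - 1) - x 1 ^ (CARD('a) - 1))"
  by (simp add: pencil_form_def pencil_mon_def mpoly_eval_add mpoly_eval_single mon_eval_add
      mon_eval_single algebra_simps)

text \<open>The monomial X_j X_0^(q-1) occurs in the form of index \<open>j\<close> alone, which
  gives injectivity and independence. For q \<ge> 3 it differs from every X_i X_1^(q-1), where X_0
  has exponent at most 1.\<close>

lemma lookup_pencil_form:
  assumes "3 \<le> CARD('a)"
  shows "Poly_Mapping.lookup (pencil_form i :: 'a::{field,finite} mpoly) (pencil_mon CARD('a) 0 j)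
    = (if i = j then 1 else 0)"
proof -
  have "pencil_mon CARD('a) 1 i \<noteq> pencil_mon CARD('a) 0 j"
  proof
    assume "pencil_mon CARD('a) 1 i = pencil_mon CARD('a) 0 j"
    then have "Poly_Mapping.lookup (pencil_mon CARD('a) 1 i) 0 = Poly_Mapping.lookup (pencil_mon CARD('a) 0 j) 0"
      by simp
    then show False
      using assms by (simp add: pencil_mon_def lookup_add lookup_single when_def split: if_splits)
  qed
  moreover have "pencil_mon CARD('a) 0 i = pencil_mon CARD('a) 0 j \<longleftrightarrow> i = j"
  proof
    assume "pencil_mon CARD('a) 0 i = pencil_mon CARD('a) 0 j"
    then have "Poly_Mapping.single i (1 :: nat) = Poly_Mapping.single j 1"
      by (simp add: pencil_mon_def)
    then have "Poly_Mapping.lookup (Poly_Mapping.single i (1 :: nat)) i = Poly_Mapping.lookup (Poly_Mapping.single j 1) i"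
      by simp
    then show "i = j"
      by (simp add: lookup_single when_def split: if_splits)
  qed simp
  ultimately show ?thesis
    by (simp add: pencil_form_def lookup_add lookup_single when_def)
qed

lemma inj_pencil_form:
  assumes "3 \<le> CARD('a)"
  shows "inj (pencil_form :: nat \<Rightarrow> 'a::{field,finite} mpoly)"
proof (rule injI)
  fix i j assume eq: "(pencil_form i :: 'a mpoly) = pencil_form j"
  from lookup_pencil_form[OF assms, of i i, unfolded eq] lookup_pencil_form[OF assms, of j i]
  show "i = j"
    by (simp split: if_splits)
qed

lemma independent_pencil_forms:
  assumes "3 \<le> CARD('a)"
  shows "mpoly.independent (pencil_form ` {..m} :: 'a::{field,finite} mpoly set)"
proof
  assume "mpoly.dependent (pencil_form ` {..m} :: 'a mpoly set)"
  then obtain c where c: "\<exists>F\<in>pencil_form ` {..m}. c F \<noteq> 0"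
      "(\<Sum>F\<in>pencil_form ` {..m}. mpoly_scale (c F) F) = (0 :: 'a mpoly)"
    using mpoly.dependent_finite[of "pencil_form ` {..m}"] by auto
  then obtain j where j: "j \<le> m" "c (pencil_form j) \<noteq> 0" by auto
  have "(\<Sum>i\<le>m. mpoly_scale (c (pencil_form i)) (pencil_form i)) = (0 :: 'a mpoly)"
    using c(2) inj_on_subset[OF inj_pencil_form[OF assms] subset_UNIV] by (simp add: sum.reindex)
  then have "Poly_Mapping.lookup (\<Sum>i\<le>m. mpoly_scale (c (pencil_form i)) (pencil_form i :: 'a mpoly))
      (pencil_mon CARD('a) 0 j) = 0"
    by simp
  then show False
    using j by (simp add: lookup_sum lookup_mpoly_scale lookup_pencil_form[OF assms] if_distrib cong: if_cong)
qed

text \<open>A nonzero vector is a common zero exactly if its first two coordinates are both zero or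
  both nonzero.\<close>

lemma card_proj_zeros_pencil_forms:
  assumes "m > 0"
  shows "(CARD('a) - 1) * card (proj_zeros m (pencil_form ` {..m} :: 'a::{field,finite} mpoly set)) + 1
    = (CARD('a) - 1) ^ 2 * CARD('a) ^ (m - 1) + CARD('a) ^ (m - 1)"
proof -
  obtain n where m: "m = Suc n"
    using assms gr0_implies_Suc by blast
  have sub: "(pencil_form ` {..m} :: 'a mpoly set) \<subseteq> forms m CARD('a)"
    using pencil_form_in_forms assms by blast
  let ?A = "\<lambda>B. {x \<in> pts (Suc (Suc n)). x 0 \<in> B \<and> x 1 \<in> (B :: 'a set)}"
  have vanish: "(\<forall>F\<in>pencil_form ` {..m}. mpoly_eval x F = 0) \<longleftrightarrow> (x 0 = 0 \<longleftrightarrow> x 1 = 0)"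
    if x: "x \<in> nonzero_vecs m" for x :: "nat \<Rightarrow> 'a"
  proof -
    obtain i where "i \<le> m" "x i \<noteq> 0"
      using x by (auto simp: nonzero_vecs_def)
    then show ?thesis
      by (auto simp: mpoly_eval_pencil_form power_card_minus_1_field simp del: One_nat_def)
  qed
  \<comment> \<open>Adding the zero vector turns the zero set into a disjoint union of two
    boxes.\<close>
  have "insert (\<lambda>_. 0) {x \<in> nonzero_vecs m. \<forall>F\<in>pencil_form ` {..m}. mpoly_eval x F = (0 :: 'a)}
      = insert (\<lambda>_. 0) {x \<in> nonzero_vecs m. x 0 = 0 \<longleftrightarrow> x 1 = (0 :: 'a)}"
    using vanish by blast
  also have "\<dots> = ?A (- {0}) \<union> ?A {0}"
    unfolding nonzero_vecs_eq m by (auto simp: pts_def)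
  finally have "card (insert (\<lambda>_. 0) {x \<in> nonzero_vecs m. \<forall>F\<in>pencil_form ` {..m}. mpoly_eval x F = (0 :: 'a)})
      = card (?A (- {0}) \<union> ?A {0})"
    by simp
  also have "\<dots> = card (?A (- {0})) + card (?A {0})"
    by (rule card_Un_disjoint) (auto simp: finite_pts)
  also have "\<dots> = (CARD('a) - 1) ^ 2 * CARD('a) ^ (m - 1) + CARD('a) ^ (m - 1)"
    unfolding card_pts_first_two by (simp add: m Compl_eq_Diff_UNIV card_Diff_singleton power2_eq_square)
  also have "card (insert (\<lambda>_. 0) {x \<in> nonzero_vecs m. \<forall>F\<in>pencil_form ` {..m}. mpoly_eval x F = (0 :: 'a)})
      = card {x \<in> nonzero_vecs m. \<forall>F\<in>pencil_form ` {..m}. mpoly_eval x F = (0 :: 'a)} + 1"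
  proof -
    have "finite (nonzero_vecs m :: (nat \<Rightarrow> 'a) set)" "(\<lambda>_. 0) \<notin> (nonzero_vecs m :: (nat \<Rightarrow> 'a) set)"
      by (simp_all add: nonzero_vecs_eq finite_pts)
    then show ?thesis by simp
  qed
  finally show ?thesis
    by (simp only: card_proj_zeros[OF sub])
qed

text \<open>The nonzero common zeros, the zero vector and the support of the span are disjoint among
  \<open>q ^ (m + 1)\<close> vectors. Since the forms are independent, the span has more than
  \<open>q ^ m\<close> elements, so its support is large.\<close>

lemma card_proj_zeros_le:
  fixes \<F> :: "'a::{field,finite} mpoly set"
  assumes \<F>: "\<F> \<subseteq> forms m CARD('a)" "finite \<F>" "card \<F> = m + 1" "mpoly.independent \<F>"
    and m: "m > 0"
  shows "(CARD('a) - 1) * card (proj_zeros m \<F>) + 1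
    \<le> (CARD('a) - 1) ^ 2 * CARD('a) ^ (m - 1) + CARD('a) ^ (m - 1)"
proof -
  let ?q = "CARD('a)"
  let ?W = "range (span_fun \<F>)"
  let ?Z = "{x \<in> nonzero_vecs m. \<forall>F\<in>\<F>. mpoly_eval x F = 0}"
  have q: "2 \<le> ?q"
    by (rule card_field_ge_2)
  have "?q ^ m < ?q ^ (m + 1)"
    using q by simp
  also have "\<dots> \<le> card ?W"
    using card_range_span_fun[OF \<F>(1,2,4)] \<F>(3) by simp
  finally have W: "2 * (real ?q - 1) * real ?q ^ m \<le> real ?q * card (supp (Suc m) ?W)"
    by (intro card_supp_hform_space_ge hform_space_span_fun \<F>(1))
  have pow: "?q ^ m = ?q * ?q ^ (m - 1)"
    using m by (cases m) auto
  have "real ?q * (2 * (real ?q - 1) * real ?q ^ (m - 1)) \<le> real ?q * card (supp (Suc m) ?W)"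
    using W m by (cases m) (simp_all add: mult_ac)
  then have "2 * (real ?q - 1) * real ?q ^ (m - 1) \<le> card (supp (Suc m) ?W)"
    using q by simp
  then have "real (2 * (?q - 1) * ?q ^ (m - 1)) \<le> card (supp (Suc m) ?W)"
    using q by (simp add: of_nat_diff)
  then have S: "2 * (?q - 1) * ?q ^ (m - 1) \<le> card (supp (Suc m) ?W)"
    by (simp only: of_nat_le_iff)
  have "?Z \<inter> supp (Suc m) ?W = {}"
    by (auto simp: supp_def span_fun_def)
  moreover have "(\<lambda>_. 0) \<notin> supp (Suc m) ?W"
    using hform_zero_at_0[OF hform_space.hform[OF hform_space_span_fun[OF \<F>(1)]]]
    by (auto simp: supp_def)
  moreover have "?Z \<subseteq> pts (Suc m)" "(\<lambda>_. 0) \<notin> ?Z"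
    by (auto simp: nonzero_vecs_eq)
  moreover have "finite ?Z"
    by (simp add: nonzero_vecs_eq finite_pts)
  ultimately have "card ?Z + 1 + card (supp (Suc m) ?W) = card (insert (\<lambda>_. 0) (?Z \<union> supp (Suc m) ?W))"
    by (simp add: card_Un_disjoint finite_supp)
  also have "\<dots> \<le> card (pts (Suc m) :: (nat \<Rightarrow> 'a) set)"
    by (intro card_mono finite_pts) (auto simp: supp_def nonzero_vecs_eq, simp add: pts_def)
  finally have "(?q - 1) * card (proj_zeros m \<F>) + 1 + 2 * (?q - 1) * ?q ^ (m - 1) \<le> ?q * ?q * ?q ^ (m - 1)"
    using S unfolding card_proj_zeros[OF \<F>(1)] card_pts by (simp add: pow)
  \<comment> \<open>This splitting of q^2 separates the bound for the zeros from that for the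
    support.\<close>
  moreover have "?q * ?q = (?q - 1) ^ 2 + 1 + 2 * (?q - 1)"
    using q by (cases ?q) (auto simp: power2_eq_square)
  then have "?q * ?q * ?q ^ (m - 1) = (?q - 1) ^ 2 * ?q ^ (m - 1) + ?q ^ (m - 1) + 2 * (?q - 1) * ?q ^ (m - 1)"
    by (simp add: distrib_right)
  ultimately show ?thesis by linarith
qed

theorem theorem6p3:
  fixes q m :: nat
  assumes "CARD('a::{field,finite}) = q" and "q \<ge> 3" and "m > 0"
  shows "max_zeros TYPE('a) (m + 1) q m = (q - 1) * q ^ (m - 1) + proj_count q (int m - 2)"
proof -
  let ?v = "(q - 1) * q ^ (m - 1) + proj_count q (int m - 2)"
  let ?S = "{card (proj_zeros m \<F>) | \<F> :: 'a mpoly set.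
    \<F> \<subseteq> forms m q \<and> finite \<F> \<and> card \<F> = m + 1 \<and> mpoly.independent \<F>}"
  \<comment> \<open>The bound and the example are both counted as (q - 1) k + 1, the number of zero
    vectors including the origin; the claimed value is put in that form.\<close>
  have v: "(q - 1) * ?v + 1 = (q - 1) ^ 2 * q ^ (m - 1) + q ^ (m - 1)"
    using proj_count_eq[of q m] assms(2,3) by (simp add: distrib_left power2_eq_square)
  have le: "k \<le> ?v" if k: "k \<in> ?S" for k
  proof -
    obtain \<F> :: "'a mpoly set" where \<F>: "k = card (proj_zeros m \<F>)"
        "\<F> \<subseteq> forms m CARD('a)" "finite \<F>" "card \<F> = m + 1" "mpoly.independent \<F>"
      using k assms(1) by auto
    have "(q - 1) * k + 1 \<le> (q - 1) * ?v + 1"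
      unfolding v \<F>(1) using card_proj_zeros_le[OF \<F>(2-5) assms(3)] assms(1) by simp
    then show ?thesis
      using assms(2) by simp
  qed
  let ?\<F> = "pencil_form ` {..m} :: 'a mpoly set"
  have inj: "inj (pencil_form :: nat \<Rightarrow> 'a mpoly)"
    using inj_pencil_form assms by blast
  have "?\<F> \<subseteq> forms m q"
    using pencil_form_in_forms[where 'a = 'a, of _ m] assms(1,3) by blast
  moreover have "card ?\<F> = m + 1"
    using card_image[OF inj_on_subset[OF inj subset_UNIV], of "{..m}"] by simp
  moreover have "mpoly.independent ?\<F>"
    using independent_pencil_forms[where 'a = 'a, of m] assms(1,2) by simp
  ultimately have "card (proj_zeros m ?\<F>) \<in> ?S"
    by blast
  moreover have "(q - 1) * card (proj_zeros m ?\<F>) + 1 = (q - 1) * ?v + 1"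
    unfolding v using card_proj_zeros_pencil_forms[where 'a = 'a, of m] assms by simp
  then have "card (proj_zeros m ?\<F>) = ?v"
    using assms(2) by simp
  ultimately have "?v \<in> ?S"
    by simp
  moreover have "finite ?S"
    by (rule finite_subset[of _ "{..?v}"]) (use le in blast)+
  ultimately have "Max ?S = ?v"
    using le by (intro Max_eqI)
  then show ?thesis
    unfolding max_zeros_def .
qed

end
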